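(* Let $\hat v\in PC^2[0;p_0]$ be an extremal, on the interval $[0;p_0]$, from the field of extremals described in the context (an admissible trajectory of the problem $J(v)\to\min$, $v''\ge 0$, $v(0)=M$, $v(p_0)=p_0$, with $M=\hat v(0)$). Then there exists $\varepsilon>0$ such that for every $h\in PC^2[0;p_0]$ with $h(0)=h(p_0)=h'(p_0)=0$, $\|h''\|\le\varepsilon$ and $\hat v+h$ convex, one has $$J(\hat v+h)\ge J(\hat v).$$
   Context: $PC^2[0;p_0]$ is the class of $C^1$ functions on $[0;p_0]$ whose second derivative is piecewise continuous; $\|\cdot\|$ is the supremum norm on $[0;p_0]$. The functional is $J(v)=\int_0^{p_0} f(p,v(p),v'(p))\,dp$ with $$f(p,v,v')=\frac{2\sqrt{v^2-p^2}\,(v')^2}{(1+v^2)^2}-\frac{pv'-v}{v(1+v^2)\sqrt{v^2-p^2}} .$$ Optimal control problem: minimize $J(v)$ subject to $v'=w$, $w'=\theta\ge 0$, $v(0)=M$, $v(p_0)=p_0<\infty$. Pontryagin's Maximum Principle (with $\lambda_0=1$) for a trajectory $v$ with $\theta=v''\ge0$: there exist functions $\varphi,\psi$ with $\varphi'=f_v$ and $\psi'=f_{v'}-\varphi$ along $v$, such that $\psi\le 0$, $\psi=0$ on the support of $\theta$, $\psi(0)=\psi(p_0)=0$, and $\varphi-H\to0$ as $p\to p_0-0$, where $H=-f(p,v,w)+\varphi w+\psi\theta$. Field of extremals: for all sufficiently large $p_0$ (i.e. $p_0\ge P_0$ for a suitable $P_0$) the field contains a convex trajectory $v(\cdot)=v(\cdot;p_0)\in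 PC^2[0;p_0]$ with $v(p_0)=p_0$, $v'(p_0)=1$, $v(p)>p$ for $p\in[0;p_0)$, and a switching point $r(p_0)\in(0;p_0)$, such that: (1) on $[r(p_0);p_0]$ the trajectory is singular ($\psi\equiv0$), is strictly convex, and is the restriction of the analytic solution of $$v''=-\frac14\frac{(v'-1)^2}{v-p}-\frac14\frac{(v'+1)^2}{v+p}+\frac{2v v'^2}{1+v^2}$$ with $v(p_0)=p_0$, $v'(p_0)=1$, $v'\neq1$ in a punctured neighbourhood of $p_0$ (so $v''(p_0)=\frac{3p_0^2-1}{3p_0(1+p_0^2)}>0$); (2) on $[0;r(p_0)]$ the trajectory is affine ($v''=0$), joined at $r(p_0)$ continuously together with its first derivative, and $\psi<0$ on $(0;r(p_0))$; (3) $v$ satisfies Pontryagin's Maximum Principle with $\lambda_0=1$ as stated above; in particular $r(p_0)$ is determined by the condition $\psi(0)=\int_0^{r(p_0)}p\,(f_{pv'}+f_{vv'}v'-f_v)\,dp=0$ (evaluated along the affine piece); (4) the Jacobi equation $\frac{d}{dp}(f_{v'v'}\xi'+f_{v'v}\xi)=f_{v'v}\xi'+f_{vv}\xi$ along $v$ on $[0;p_0]$ has a unique solution with $\xi(p_0)=0$, $\xi'(p_0)=1$, and $\xi(p)\ne0$ for $p\in[0;p_0)$. *)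

theory Defs
  imports "HOL-Analysis.Analysis"
begin

section \<open>Functions on a compact interval\<close>

text \<open>Derivative of a function regarded as a function on [0;b] only: one-sided at the two end points.\<close>

definition D1 :: "real \<Rightarrow> (real \<Rightarrow> real) \<Rightarrow> real \<Rightarrow> real" where
  "D1 b v p = vector_derivative v (at p within {0..b})"

text \<open>At a corner of \<open>v'\<close> the value \<open>D2 b v p\<close> is arbitrary; it is only meaningful on \<open>dom2 b v\<close>.\<close>

definition D2 :: "real \<Rightarrow> (real \<Rightarrow> real) \<Rightarrow> real \<Rightarrow> real" where
  "D2 b v = D1 b (D1 b v)"

definition dom2 :: "real \<Rightarrow> (real \<Rightarrow> real) \<Rightarrow> real set" where
  "dom2 b v = {p \<in> {0..b}. D1 b v differentiable (at p within {0..b})}"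

definition C1_on :: "real \<Rightarrow> (real \<Rightarrow> real) \<Rightarrow> bool" where
  "C1_on b v \<longleftrightarrow> v differentiable_on {0..b} \<and> continuous_on {0..b} (D1 b v)"

text \<open>Piecewise continuity includes the existence of finite one-sided limits at every point.\<close>

definition PC2 :: "real \<Rightarrow> (real \<Rightarrow> real) \<Rightarrow> bool" where
  "PC2 b v \<longleftrightarrow> C1_on b v \<and>
     (\<exists>S. finite S \<and> {0..b} - S \<subseteq> dom2 b v \<and> continuous_on ({0..b} - S) (D2 b v)) \<and>
     (\<forall>p\<in>{0<..b}. \<exists>l. (D2 b v \<longlongrightarrow> l) (at_left p)) \<and>
     (\<forall>p\<in>{0..<b}. \<exists>l. (D2 b v \<longlongrightarrow> l) (at_right p))"

definition sup_norm :: "real set \<Rightarrow> (real \<Rightarrow> real) \<Rightarrow> ereal" where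
  "sup_norm A g = (SUP p\<in>A. ereal \<bar>g p\<bar>)"

definition strictly_convex_on :: "real set \<Rightarrow> (real \<Rightarrow> real) \<Rightarrow> bool" where
  "strictly_convex_on A v \<longleftrightarrow> convex A \<and>
     (\<forall>x\<in>A. \<forall>y\<in>A. \<forall>t\<in>{0<..<1}. x \<noteq> y \<longrightarrow>
        v ((1 - t) * x + t * y) < (1 - t) * v x + t * v y)"

definition real_analytic_on :: "(real \<Rightarrow> real) \<Rightarrow> real set \<Rightarrow> bool" where
  "real_analytic_on u A \<longleftrightarrow>
     (\<forall>x\<in>A. \<exists>e>0. \<exists>a. \<forall>y. \<bar>y - x\<bar> < e \<longrightarrow> (\<lambda>n. a n * (y - x) ^ n) sums u y)"


section \<open>The functional\<close>

definition f :: "real \<Rightarrow> real \<Rightarrow> real \<Rightarrow> real" where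
  "f p v w = 2 * sqrt (v\<^sup>2 - p\<^sup>2) * w\<^sup>2 / (1 + v\<^sup>2)\<^sup>2
             - (p * w - v) / (v * (1 + v\<^sup>2) * sqrt (v\<^sup>2 - p\<^sup>2))"

text \<open>Partial derivatives; the index \<open>w\<close> refers to the slot of \<open>v'\<close>.\<close>

definition f_v :: "real \<Rightarrow> real \<Rightarrow> real \<Rightarrow> real" where
  "f_v p v w = deriv (\<lambda>x. f p x w) v"

definition f_w :: "real \<Rightarrow> real \<Rightarrow> real \<Rightarrow> real" where
  "f_w p v w = deriv (\<lambda>y. f p v y) w"

definition f_vv :: "real \<Rightarrow> real \<Rightarrow> real \<Rightarrow> real" where
  "f_vv p v w = deriv (\<lambda>x. f_v p x w) v"

definition f_vw :: "real \<Rightarrow> real \<Rightarrow> real \<Rightarrow> real" where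
  "f_vw p v w = deriv (\<lambda>x. f_w p x w) v"

definition f_pw :: "real \<Rightarrow> real \<Rightarrow> real \<Rightarrow> real" where
  "f_pw p v w = deriv (\<lambda>q. f_w q v w) p"

definition f_ww :: "real \<Rightarrow> real \<Rightarrow> real \<Rightarrow> real" where
  "f_ww p v w = deriv (\<lambda>y. f_w p v y) w"

text \<open>At the end point \<open>b\<close>, where \<open>v b = b\<close>, the integrand takes a default value, which does not
  influence the integral.\<close>

definition J :: "real \<Rightarrow> (real \<Rightarrow> real) \<Rightarrow> real" where
  "J b v = integral {0..b} (\<lambda>p. f p (v p) (D1 b v p))"


section \<open>Pontryagin's Maximum Principle\<close>

definition hamiltonian :: "real \<Rightarrow> real \<Rightarrow> real \<Rightarrow> real \<Rightarrow> real \<Rightarrow> real \<Rightarrow> real" where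
  "hamiltonian p v w \<theta> \<phi> \<psi> = - f p v w + \<phi> * w + \<psi> * \<theta>"

text \<open>The integrand is singular at \<open>p = b\<close>, so the adjoint equations are imposed on [0;b).\<close>

definition pontryagin ::
    "real \<Rightarrow> (real \<Rightarrow> real) \<Rightarrow> (real \<Rightarrow> real) \<Rightarrow> (real \<Rightarrow> real) \<Rightarrow> bool" where
  "pontryagin b v \<phi> \<psi> \<longleftrightarrow>
     (\<forall>p\<in>dom2 b v. 0 \<le> D2 b v p) \<and>
     (\<forall>p\<in>{0..<b}. (\<phi> has_real_derivative f_v p (v p) (D1 b v p)) (at p within {0..<b})) \<and>
     (\<forall>p\<in>{0..<b}. (\<psi> has_real_derivative (f_w p (v p) (D1 b v p) - \<phi> p)) (at p within {0..<b})) \<and>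
     continuous_on {0..b} \<psi> \<and>
     (\<forall>p\<in>{0..b}. \<psi> p \<le> 0) \<and>
     (\<forall>p\<in>closure {p \<in> dom2 b v. D2 b v p \<noteq> 0}. \<psi> p = 0) \<and>
     \<psi> 0 = 0 \<and> \<psi> b = 0 \<and>
     ((\<lambda>p. \<phi> p - hamiltonian p (v p) (D1 b v p) (D2 b v p) (\<phi> p) (\<psi> p)) \<longlongrightarrow> 0) (at_left b)"


section \<open>The field of extremals\<close>

definition singular_ode_on :: "real set \<Rightarrow> (real \<Rightarrow> real) \<Rightarrow> bool" where
  "singular_ode_on A u \<longleftrightarrow>
     (\<forall>p\<in>A. u p \<noteq> p \<and> u p \<noteq> - p \<and>
        deriv (deriv u) p =
          - (1/4) * (deriv u p - 1)\<^sup>2 / (u p - p) - (1/4) * (deriv u p + 1)\<^sup>2 / (u p + p)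
          + 2 * u p * (deriv u p)\<^sup>2 / (1 + (u p)\<^sup>2))"

text \<open>The right-hand side of the equation is of the form 0/0 at \<open>p = b\<close>, hence \<open>A - {b}\<close>.\<close>

definition singular_arc :: "real \<Rightarrow> real \<Rightarrow> (real \<Rightarrow> real) \<Rightarrow> bool" where
  "singular_arc b r v \<longleftrightarrow>
     (\<exists>A u. open A \<and> {r..b} \<subseteq> A \<and> real_analytic_on u A \<and>
        singular_ode_on (A - {b}) u \<and>
        u b = b \<and> deriv u b = 1 \<and> (\<forall>\<^sub>F p in at b. deriv u p \<noteq> 1) \<and>
        deriv (deriv u) b = (3 * b\<^sup>2 - 1) / (3 * b * (1 + b\<^sup>2)) \<and> deriv (deriv u) b > 0 \<and>
        (\<forall>p\<in>{r..b}. v p = u p))"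

definition jacobi_solution :: "real \<Rightarrow> (real \<Rightarrow> real) \<Rightarrow> (real \<Rightarrow> real) \<Rightarrow> bool" where
  "jacobi_solution b v \<xi> \<longleftrightarrow>
     C1_on b \<xi> \<and> \<xi> b = 0 \<and> D1 b \<xi> b = 1 \<and>
     (\<forall>p\<in>{0..<b}.
        ((\<lambda>q. f_ww q (v q) (D1 b v q) * D1 b \<xi> q + f_vw q (v q) (D1 b v q) * \<xi> q)
           has_real_derivative
           (f_vw p (v p) (D1 b v p) * D1 b \<xi> p + f_vv p (v p) (D1 b v p) * \<xi> p))
        (at p within {0..<b}))"

text \<open>On the affine piece \<open>v'' = 0\<close> the adjoint equations give
  \<open>\<psi>'' = f_pw + f_vw v' - f_v\<close>, and \<open>\<psi> r = \<psi>' r = 0\<close> then gives \<open>\<psi> 0\<close> as the integral below.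
  Continuity of \<open>v\<close> and \<open>v'\<close> at \<open>r\<close> is contained in \<open>PC2\<close>.\<close>

definition field_extremal :: "real \<Rightarrow> real \<Rightarrow> (real \<Rightarrow> real) \<Rightarrow> bool" where
  "field_extremal b r v \<longleftrightarrow>
     PC2 b v \<and> convex_on {0..b} v \<and>
     v b = b \<and> D1 b v b = 1 \<and> (\<forall>p\<in>{0..<b}. p < v p) \<and>
     0 < r \<and> r < b \<and>
     strictly_convex_on {r..b} v \<and> singular_arc b r v \<and>
     (\<exists>c d. \<forall>p\<in>{0..r}. v p = c + d * p) \<and>
     (\<exists>\<phi> \<psi>. pontryagin b v \<phi> \<psi> \<and>
        (\<forall>p\<in>{r..b}. \<psi> p = 0) \<and> (\<forall>p\<in>{0<..<r}. \<psi> p < 0) \<and>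
        ((\<lambda>p. p * (f_pw p (v p) (D1 b v p) + f_vw p (v p) (D1 b v p) * D1 b v p
                   - f_v p (v p) (D1 b v p))) has_integral \<psi> 0) {0..r}) \<and>
     (\<exists>\<xi>. jacobi_solution b v \<xi> \<and>
        (\<forall>\<eta>. jacobi_solution b v \<eta> \<longrightarrow> (\<forall>p\<in>{0..b}. \<eta> p = \<xi> p)) \<and>
        (\<forall>p\<in>{0..<b}. \<xi> p \<noteq> 0))"

text \<open>\<open>V b\<close> is the trajectory \<open>v(\<cdot>;b)\<close> and \<open>r b\<close> its switching point.\<close>

definition field_of_extremals ::
    "real \<Rightarrow> (real \<Rightarrow> real) \<Rightarrow> (real \<Rightarrow> real \<Rightarrow> real) \<Rightarrow> bool" where
  "field_of_extremals P r V \<longleftrightarrow> 0 < P \<and> (\<forall>b\<ge>P. field_extremal b (r b) (V b))"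

end

theory Submission
  imports Defs
begin

text \<open>
  Write \<open>s = b - p\<close> and \<open>u = sqrt (v\<^sup>2 - p\<^sup>2)\<close>. Along the extremal \<open>v - p\<close> is of order \<open>s\<^sup>2\<close>, so the
  derivatives of \<open>f\<close> blow up at \<open>b\<close> too fast for a direct Taylor estimate. Subtracting the total
  derivative of an explicit \<open>N(p, v)\<close> removes the singular part, \<open>f = N_p + N_v v' + \<Lambda>\<close>, and the second
  derivatives of \<open>\<Lambda>\<close> have sizes \<open>1/s\<close>, \<open>1\<close>, \<open>s\<close>. Divided by these sizes they are continuous functions
  of \<open>p\<close>, \<open>(v - p)/s\<^sup>2\<close>, \<open>(v' - 1)/s\<close> on a compact box, hence uniformly continuous, so the remainder of
  second order of \<open>\<Lambda>\<close> is at most \<open>\<delta> (h\<^sup>2/s + s h'\<^sup>2)\<close> once \<open>h''\<close> is small.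

  The first variation is \<open>- \<integral> \<psi> h'' \<ge> 0\<close>, because \<open>\<psi> \<le> 0\<close> vanishes on the singular arc and \<open>h\<close> is convex
  on the affine arc. With the Jacobi field \<open>\<xi>\<close> and \<open>q = h / \<xi>\<close> the second variation is
  \<open>\<integral> f_ww \<xi>\<^sup>2 q'\<^sup>2 \<ge> c \<integral> s\<^sup>3 q'\<^sup>2\<close>, and Hardy's inequality \<open>\<integral> s q\<^sup>2 \<le> \<integral> s\<^sup>3 q'\<^sup>2\<close> turns this into a bound
  from below by a multiple of \<open>\<integral> (h\<^sup>2/s + s h'\<^sup>2)\<close>, which absorbs the remainder.
\<close>

section \<open>A null Lagrangian\<close>

definition uu :: "real \<Rightarrow> real \<Rightarrow> real" where "uu p v = sqrt (v\<^sup>2 - p\<^sup>2)"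
text \<open>\<open>gg\<close> and \<open>mm\<close> are the factors of \<open>f\<close> that depend
  on \<open>v\<close> alone: \<open>f = 2 * u * w^2 * gg v - (p * w - v) * mm v / u\<close>. A
  trailing digit, here and for \<open>qq\<close>, counts derivatives in \<open>v\<close>.\<close>

definition gg :: "real \<Rightarrow> real" where "gg v = 1 / (1 + v\<^sup>2)\<^sup>2"
definition gg1 :: "real \<Rightarrow> real" where "gg1 v = - 4 * v / (1 + v\<^sup>2)^3"
definition gg2 :: "real \<Rightarrow> real" where "gg2 v = - 4 / (1 + v\<^sup>2)^3 + 24 * v\<^sup>2 / (1 + v\<^sup>2)^4"
definition mm :: "real \<Rightarrow> real" where "mm v = 1 / (v + v^3)"
definition mm1 :: "real \<Rightarrow> real" where "mm1 v = - (1 + 3 * v\<^sup>2) / (v + v^3)\<^sup>2"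
definition mm2 :: "real \<Rightarrow> real" where
  "mm2 v = - 6 * v / (v + v^3)\<^sup>2 + 2 * (1 + 3 * v\<^sup>2)\<^sup>2 / (v + v^3)^3"
definition mm3 :: "real \<Rightarrow> real" where
  "mm3 v = - 6 / (v + v^3)\<^sup>2 + 36 * v * (1 + 3 * v\<^sup>2) / (v + v^3)^3
     - 6 * (1 + 3 * v\<^sup>2)^3 / (v + v^3)^4"

lemma v_cube_pos: "0 < v \<Longrightarrow> 0 < v + v^3" for v :: real
  by (simp add: add_pos_pos)

lemma one_sq_pos: "0 < 1 + v\<^sup>2" for v :: real
  by (simp add: add_pos_nonneg)

lemma uu_pos: "0 \<le> p \<Longrightarrow> p < v \<Longrightarrow> 0 < uu p v"
  by (simp add: uu_def power_strict_mono)

lemma uu_sq: "0 \<le> p \<Longrightarrow> p < v \<Longrightarrow> (uu p v)\<^sup>2 = v\<^sup>2 - p\<^sup>2"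
  by (simp add: uu_def power_mono)

lemma DERIV_gg [derivative_intros]:
  assumes "(X has_real_derivative X') (at t within S)"
  shows "((\<lambda>t. gg (X t)) has_real_derivative gg1 (X t) * X') (at t within S)"
  unfolding gg_def gg1_def
  apply (rule derivative_eq_intros assms refl)+
  using one_sq_pos[of "X t"] by (simp_all add: divide_simps, algebra?)

lemma DERIV_gg1 [derivative_intros]:
  assumes "(X has_real_derivative X') (at t within S)"
  shows "((\<lambda>t. gg1 (X t)) has_real_derivative gg2 (X t) * X') (at t within S)"
  unfolding gg1_def gg2_def
  apply (rule derivative_eq_intros assms refl)+
  using one_sq_pos[of "X t"] apply simp
  using one_sq_pos[of "X t"] by (simp add: divide_simps) algebra

lemma DERIV_mm [derivative_intros]:
  assumes "(X has_real_derivative X') (at t within S)" "0 < X t"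
  shows "((\<lambda>t. mm (X t)) has_real_derivative mm1 (X t) * X') (at t within S)"
  unfolding mm_def mm1_def
  apply (rule derivative_eq_intros assms refl)+
  using v_cube_pos[OF assms(2)] apply simp
  using v_cube_pos[OF assms(2)] by (simp add: divide_simps) algebra

lemma DERIV_mm1 [derivative_intros]:
  assumes "(X has_real_derivative X') (at t within S)" "0 < X t"
  shows "((\<lambda>t. mm1 (X t)) has_real_derivative mm2 (X t) * X') (at t within S)"
  unfolding mm1_def mm2_def
  apply (rule derivative_eq_intros assms refl)+
  using v_cube_pos[OF assms(2)] apply simp
  using v_cube_pos[OF assms(2)] by (simp add: divide_simps) algebra

lemma DERIV_mm2 [derivative_intros]:
  assumes "(X has_real_derivative X') (at t within S)" "0 < X t"
  shows "((\<lambda>t. mm2 (X t)) has_real_derivative mm3 (X t) * X') (at t within S)"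
proof -
  have d: "0 < X t + X t ^ 3" by (rule v_cube_pos[OF assms(2)])
  then have nz: "(X t + X t ^ 3)\<^sup>2 \<noteq> 0" "(X t + X t ^ 3) ^ 3 \<noteq> 0" by auto
  show ?thesis
    unfolding mm2_def mm3_def
    apply (rule derivative_eq_intros assms refl nz)+
    using d by (simp add: divide_simps) algebra
qed

lemma DERIV_uu [derivative_intros]:
  assumes "(P has_real_derivative P') (at t within S)" "(X has_real_derivative X') (at t within S)"
    and "0 \<le> P t" "P t < X t"
  shows "((\<lambda>t. uu (P t) (X t)) has_real_derivative (X t * X' - P t * P') / uu (P t) (X t))
    (at t within S)"
proof -
  have "0 < (X t)\<^sup>2 - (P t)\<^sup>2" using assms by (simp add: power_strict_mono)
  then show ?thesis
    unfolding uu_def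
    by - (rule derivative_eq_intros assms refl | simp add: field_simps)+
qed

text \<open>
  The coefficient \<open>- mm v\<close> of \<open>u\<close> makes the singular terms of order \<open>1/u\<close> cancel; the parameter \<open>k\<close> will be
  \<open>ee b\<close> below, the value for which the coefficient of \<open>v' - 1\<close> in \<open>WW\<close> vanishes at \<open>p = v = b\<close>.
  The suffixes \<open>p\<close>, \<open>v\<close> denote partial derivatives, and \<open>u\<close> is kept as an independent symbol, so that
  no relation between \<open>u\<close>, \<open>v\<close>, \<open>p\<close> is needed to verify them.
\<close>

definition NN :: "real \<Rightarrow> real \<Rightarrow> real \<Rightarrow> real" where
  "NN k p v = - uu p v * mm v + k / 3 * uu p v ^ 3"
definition NNp :: "real \<Rightarrow> real \<Rightarrow> real \<Rightarrow> real" where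
  "NNp k p v = p / uu p v * mm v - k * uu p v * p"
definition NNv :: "real \<Rightarrow> real \<Rightarrow> real \<Rightarrow> real" where
  "NNv k p v = - (v / uu p v) * mm v - uu p v * mm1 v + k * uu p v * v"
definition NNpv :: "real \<Rightarrow> real \<Rightarrow> real \<Rightarrow> real" where
  "NNpv k p v = - (p * v / uu p v ^ 3) * mm v + p / uu p v * mm1 v - k * p * v / uu p v"
definition NNvv :: "real \<Rightarrow> real \<Rightarrow> real \<Rightarrow> real" where
  "NNvv k p v = - (1 / uu p v - v\<^sup>2 / uu p v ^ 3) * mm v - 2 * (v / uu p v) * mm1 v
     - uu p v * mm2 v + k * (uu p v + v\<^sup>2 / uu p v)"
definition NNpvv :: "real \<Rightarrow> real \<Rightarrow> real \<Rightarrow> real" where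
  "NNpvv k p v = - (p / uu p v ^ 3 - 3 * p * v\<^sup>2 / uu p v ^ 5) * mm v
     - 2 * (p * v / uu p v ^ 3) * mm1 v + p / uu p v * mm2 v
     - k * p / uu p v + k * p * v\<^sup>2 / uu p v ^ 3"
definition NNvvv :: "real \<Rightarrow> real \<Rightarrow> real \<Rightarrow> real" where
  "NNvvv k p v = (3 * v / uu p v ^ 3 - 3 * v ^ 3 / uu p v ^ 5) * mm v
     - 3 * (1 / uu p v - v\<^sup>2 / uu p v ^ 3) * mm1 v
     - 3 * (v / uu p v) * mm2 v - uu p v * mm3 v + k * (3 * v / uu p v - v ^ 3 / uu p v ^ 3)"

context
  fixes P X :: "real \<Rightarrow> real" and P' X' t :: real and S
  assumes P: "(P has_real_derivative P') (at t within S)"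
    and X: "(X has_real_derivative X') (at t within S)"
    and le: "0 \<le> P t" and less: "P t < X t"
begin

text \<open>The chain rules of this block are stated along an arbitrary curve
  \<open>(P t, X t)\<close>: a constant \<open>P\<close> gives partial derivatives in
  \<open>v\<close>, and \<open>P\<close> the identity gives total derivatives along the
  extremal.\<close>

lemma DERIV_NN:
  "((\<lambda>t. NN k (P t) (X t)) has_real_derivative
     NNp k (P t) (X t) * P' + NNv k (P t) (X t) * X') (at t within S)"
proof -
  have x: "0 < X t" using le less by simp
  have u: "0 < uu (P t) (X t)" using le less by (rule uu_pos)
  show ?thesis
    unfolding NN_def NNp_def NNv_def
    apply (rule derivative_eq_intros P X refl le less x)+
    using u by (simp add: divide_simps) algebra
qed

lemma DERIV_NNv:
  "((\<lambda>t. NNv k (P t) (X t)) has_real_derivative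
     NNpv k (P t) (X t) * P' + NNvv k (P t) (X t) * X') (at t within S)"
proof -
  have x: "0 < X t" using le less by simp
  have u: "0 < uu (P t) (X t)" using le less by (rule uu_pos)
  show ?thesis
    unfolding NNv_def NNpv_def NNvv_def
    apply (rule derivative_eq_intros P X refl le less x less_imp_neq[OF u, symmetric])+
    using u by (simp add: divide_simps) algebra
qed

lemma DERIV_NNvv:
  "((\<lambda>t. NNvv k (P t) (X t)) has_real_derivative
     NNpvv k (P t) (X t) * P' + NNvvv k (P t) (X t) * X') (at t within S)"
proof -
  have x: "0 < X t" using le less by simp
  have u: "0 < uu (P t) (X t)" using le less by (rule uu_pos)
  have u3: "uu (P t) (X t) ^ 3 \<noteq> 0" using u by simp
  show ?thesis
    unfolding NNvv_def NNpvv_def NNvvv_def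
    apply (rule derivative_eq_intros P X refl le less x less_imp_neq[OF u, symmetric] u3)+
    using u by (simp add: divide_simps) algebra
qed

end

text \<open>The value \<open>NNpv\<close> also appears in \<open>DERIV_NNv\<close> as the
  \<open>p\<close>-derivative of \<open>NNv\<close>. This symmetry, and its analogue for
  \<open>NNpvv\<close>, is what later makes the contributions of \<open>N\<close> to the first and
  second variation cancel.\<close>

lemma DERIV_NNp:
  assumes "0 \<le> p" "p < x"
  shows "(NNp k p has_real_derivative NNpv k p x) (at x)"
proof -
  have x: "0 < x" using assms by simp
  have u: "0 < uu p x" using assms by (rule uu_pos)
  show ?thesis
    unfolding NNp_def[abs_def] NNpv_def
    apply (rule derivative_eq_intros refl assms x less_imp_neq[OF u, symmetric])+
    using u by (simp add: divide_simps) algebra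
qed

lemma DERIV_NNpv:
  assumes "0 \<le> p" "p < x"
  shows "(NNpv k p has_real_derivative NNpvv k p x) (at x)"
proof -
  have x: "0 < x" using assms by simp
  have u: "0 < uu p x" using assms by (rule uu_pos)
  have u3: "uu p x ^ 3 \<noteq> 0" using u by simp
  show ?thesis
    unfolding NNpv_def[abs_def] NNpvv_def
    apply (rule derivative_eq_intros refl assms x less_imp_neq[OF u, symmetric] u3)+
    using u by (simp add: divide_simps) algebra
qed

section \<open>The reduced Lagrangian\<close>

text \<open>Because \<open>(v - p) * (v + p) = u^2\<close>, the singular term
  \<open>mm v * (v - p) / u\<close> that remains of \<open>f\<close> is the regular product
  \<open>u * qq p v\<close>.\<close>

definition qq :: "real \<Rightarrow> real \<Rightarrow> real" where "qq p v = mm v / (v + p)"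
definition qq1 :: "real \<Rightarrow> real \<Rightarrow> real" where
  "qq1 p v = mm1 v / (v + p) - mm v / (v + p)\<^sup>2"
definition qq2 :: "real \<Rightarrow> real \<Rightarrow> real" where
  "qq2 p v = mm2 v / (v + p) - 2 * mm1 v / (v + p)\<^sup>2 + 2 * mm v / (v + p)^3"

lemma DERIV_qq [derivative_intros]:
  assumes "(X has_real_derivative X') (at t within S)" "0 \<le> p" "0 < X t"
  shows "((\<lambda>t. qq p (X t)) has_real_derivative qq1 p (X t) * X') (at t within S)"
proof -
  have d: "X t + p > 0" using assms by simp
  show ?thesis
    unfolding qq_def qq1_def
    apply (rule derivative_eq_intros assms refl less_imp_neq[OF d, symmetric])+
    using d by (simp add: divide_simps) algebra
qed

lemma DERIV_qq1 [derivative_intros]: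
  assumes "(X has_real_derivative X') (at t within S)" "0 \<le> p" "0 < X t"
  shows "((\<lambda>t. qq1 p (X t)) has_real_derivative qq2 p (X t) * X') (at t within S)"
proof -
  have d: "X t + p > 0" using assms by simp
  then have d2: "(X t + p)\<^sup>2 \<noteq> 0" by simp
  show ?thesis
    unfolding qq1_def qq2_def
    apply (rule derivative_eq_intros assms refl less_imp_neq[OF d, symmetric] d2)+
    using d by (simp add: divide_simps) algebra
qed

text \<open>This is \<Lambda> divided by \<open>u\<close>, while \<open>LL\<close> below is
  \<Lambda> itself. It is regular at \<open>p = v > 0\<close>, so all singular behaviour of the
  derivatives of \<Lambda> comes from the explicit factor \<open>u\<close>.\<close>

definition WW :: "real \<Rightarrow> real \<Rightarrow> real \<Rightarrow> real \<Rightarrow> real" where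
  "WW k p v w = 2 * gg v * w\<^sup>2 + (1 + w) * qq p v + mm1 v * w - k * (v * w - p)"
definition WWv :: "real \<Rightarrow> real \<Rightarrow> real \<Rightarrow> real \<Rightarrow> real" where
  "WWv k p v w = 2 * gg1 v * w\<^sup>2 + (1 + w) * qq1 p v + mm2 v * w - k * w"
definition WWw :: "real \<Rightarrow> real \<Rightarrow> real \<Rightarrow> real \<Rightarrow> real" where
  "WWw k p v w = 4 * gg v * w + qq p v + mm1 v - k * v"
definition WWvv :: "real \<Rightarrow> real \<Rightarrow> real \<Rightarrow> real" where
  "WWvv p v w = 2 * gg2 v * w\<^sup>2 + (1 + w) * qq2 p v + mm3 v * w"
definition WWvw :: "real \<Rightarrow> real \<Rightarrow> real \<Rightarrow> real \<Rightarrow> real" where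
  "WWvw k p v w = 4 * gg1 v * w + qq1 p v + mm2 v - k"

definition LL :: "real \<Rightarrow> real \<Rightarrow> real \<Rightarrow> real \<Rightarrow> real" where
  "LL k p v w = uu p v * WW k p v w"
definition LLv :: "real \<Rightarrow> real \<Rightarrow> real \<Rightarrow> real \<Rightarrow> real" where
  "LLv k p v w = v / uu p v * WW k p v w + uu p v * WWv k p v w"
definition LLw :: "real \<Rightarrow> real \<Rightarrow> real \<Rightarrow> real \<Rightarrow> real" where
  "LLw k p v w = uu p v * WWw k p v w"
definition LLvv :: "real \<Rightarrow> real \<Rightarrow> real \<Rightarrow> real \<Rightarrow> real" where
  "LLvv k p v w = (1 / uu p v - v\<^sup>2 / uu p v ^ 3) * WW k p v w
     + 2 * (v / uu p v) * WWv k p v w + uu p v * WWvv p v w"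
definition LLvw :: "real \<Rightarrow> real \<Rightarrow> real \<Rightarrow> real \<Rightarrow> real" where
  "LLvw k p v w = v / uu p v * WWw k p v w + uu p v * WWvw k p v w"
definition LLww :: "real \<Rightarrow> real \<Rightarrow> real" where
  "LLww p v = 4 * uu p v * gg v"

context
  fixes X Y :: "real \<Rightarrow> real" and X' Y' p t :: real and S
  assumes X: "(X has_real_derivative X') (at t within S)"
    and Y: "(Y has_real_derivative Y') (at t within S)"
    and le: "0 \<le> p" and less: "p < X t"
begin

lemma DERIV_WW:
  "((\<lambda>t. WW k p (X t) (Y t)) has_real_derivative
     WWv k p (X t) (Y t) * X' + WWw k p (X t) (Y t) * Y') (at t within S)"
proof -
  have x: "0 < X t" using le less by simp
  show ?thesis
    unfolding WW_def WWv_def WWw_def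
    by (rule derivative_eq_intros X Y refl le x)+ (simp, algebra)
qed

lemma DERIV_WWv:
  "((\<lambda>t. WWv k p (X t) (Y t)) has_real_derivative
     WWvv p (X t) (Y t) * X' + WWvw k p (X t) (Y t) * Y') (at t within S)"
proof -
  have x: "0 < X t" using le less by simp
  show ?thesis
    unfolding WWvw_def WWv_def WWvv_def
    by (rule derivative_eq_intros X Y refl le x)+ (simp, algebra)
qed

lemma DERIV_WWw:
  "((\<lambda>t. WWw k p (X t) (Y t)) has_real_derivative
     WWvw k p (X t) (Y t) * X' + 4 * gg (X t) * Y') (at t within S)"
proof -
  have x: "0 < X t" using le less by simp
  show ?thesis
    unfolding WWvw_def WWw_def
    by (rule derivative_eq_intros X Y refl le x)+ (simp, algebra)
qed

lemma DERIV_uu_const: 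
  "((\<lambda>t. uu p (X t)) has_real_derivative X t / uu p (X t) * X') (at t within S)"
  using DERIV_uu[OF DERIV_const X le less] by simp

lemma DERIV_LL:
  "((\<lambda>t. LL k p (X t) (Y t)) has_real_derivative
     LLv k p (X t) (Y t) * X' + LLw k p (X t) (Y t) * Y') (at t within S)"
  unfolding LL_def LLv_def LLw_def
  by (rule derivative_eq_intros DERIV_WW DERIV_uu_const refl)+ (simp add: algebra_simps)

lemma DERIV_LLv:
  "((\<lambda>t. LLv k p (X t) (Y t)) has_real_derivative
     LLvv k p (X t) (Y t) * X' + LLvw k p (X t) (Y t) * Y') (at t within S)"
proof -
  have u: "0 < uu p (X t)" using le less by (rule uu_pos)
  show ?thesis
    unfolding LLvw_def LLv_def LLvv_def
    apply (rule derivative_eq_intros DERIV_WW DERIV_WWv X refl le less less_imp_neq[OF u, symmetric])+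
    using u by (simp add: divide_simps) algebra
qed

lemma DERIV_LLw:
  "((\<lambda>t. LLw k p (X t) (Y t)) has_real_derivative
     LLvw k p (X t) (Y t) * X' + LLww p (X t) * Y') (at t within S)"
  unfolding LLvw_def LLww_def LLw_def
  by (rule derivative_eq_intros DERIV_WWw DERIV_uu_const refl)+ (simp add: algebra_simps)

end

text \<open>In \<open>f - NNp - NNv * w\<close> the terms of order \<open>1/u\<close> combine to
  \<open>(1 + w) * mm v * (v - p) / u\<close>, which is turned into
  \<open>(1 + w) * u * qq p v\<close>. The identity holds for every \<open>k\<close>, which leaves
  \<open>k\<close> free for a later choice.\<close>

lemma f_eq:
  assumes "0 \<le> p" "p < v"
  shows "f p v w = LL k p v w + NNp k p v + NNv k p v * w"
proof -
  have v: "0 < v" using assms by simp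
  have u: "0 < uu p v" using assms by (rule uu_pos)
  have sq: "uu p v * uu p v = (v - p) * (v + p)"
    using uu_sq[OF assms] by (simp add: power2_eq_square algebra_simps)
  have "qq p v * uu p v * uu p v = mm v * (v - p)"
    using assms by (simp add: qq_def mult.assoc sq)
  then have q: "uu p v * qq p v = mm v * (v - p) / uu p v"
    using u by (simp add: field_simps)
  have m: "mm v = 1 / (v * (1 + v\<^sup>2))" by (simp add: mm_def power2_eq_square power3_eq_cube algebra_simps)
  have "f p v w = 2 * uu p v * w\<^sup>2 * gg v - (p * w - v) * mm v / uu p v"
    unfolding f_def gg_def m uu_def[symmetric] by simp
  also have "\<dots> = uu p v * (2 * gg v * w\<^sup>2 + mm1 v * w - k * (v * w - p)) + (1 + w) * (uu p v * qq p v)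
     + NNp k p v + NNv k p v * w"
    unfolding q NNp_def NNv_def using u by (simp add: divide_simps) algebra
  also have "\<dots> = LL k p v w + NNp k p v + NNv k p v * w"
    unfolding LL_def WW_def by algebra
  finally show ?thesis .
qed

text \<open>The representations of \<open>f\<close> and of its derivatives are available only for
  \<open>p < v\<close>; this condition is open, so it suffices for a derivative at
  \<open>v\<close>.\<close>

lemma deriv_eq_on_greater:
  fixes F G :: "real \<Rightarrow> real"
  assumes "\<And>x. p < x \<Longrightarrow> F x = G x" "p < v" "(G has_real_derivative D) (at v)"
  shows "deriv F v = D"
proof (rule DERIV_imp_deriv)
  show "(F has_real_derivative D) (at v)"
    by (rule has_field_derivative_transform_within_open[OF assms(3), of "{p<..}"]) (use assms in auto)
qed

lemma f_w_eq:
  assumes "0 \<le> p" "p < v"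
  shows "f_w p v w = LLw k p v w + NNv k p v"
  unfolding f_w_def f_eq[OF assms, where k = k]
  by (rule DERIV_imp_deriv)
    (rule derivative_eq_intros DERIV_LL[of "\<lambda>_. v" 0 _ _ "\<lambda>w. w" 1] assms refl | simp)+

lemma f_v_eq:
  assumes "0 \<le> p" "p < v"
  shows "f_v p v w = LLv k p v w + NNpv k p v + NNvv k p v * w"
  unfolding f_v_def 
proof (rule deriv_eq_on_greater[OF _ assms(2)])
  show "f p x w = LL k p x w + NNp k p x + NNv k p x * w" if "p < x" for x
    using f_eq[OF assms(1) that] .
  have "((\<lambda>x. NNv k p x) has_real_derivative NNpv k p v * 0 + NNvv k p v * 1) (at v)"
    by (rule DERIV_NNv) (use assms in auto)
  then have N: "(NNv k p has_real_derivative NNvv k p v) (at v)" by simp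
  have "((\<lambda>x. LL k p x w) has_real_derivative LLv k p v w * 1 + LLw k p v w * 0) (at v)"
    by (rule DERIV_LL) (use assms in auto)
  then have L: "((\<lambda>x. LL k p x w) has_real_derivative LLv k p v w) (at v)" by simp
  show "((\<lambda>x. LL k p x w + NNp k p x + NNv k p x * w) has_real_derivative
    LLv k p v w + NNpv k p v + NNvv k p v * w) (at v)"
    by (rule derivative_eq_intros L N DERIV_NNp assms refl)+ simp
qed

lemma f_vw_eq:
  assumes "0 \<le> p" "p < v"
  shows "f_vw p v w = LLvw k p v w + NNvv k p v"
  unfolding f_vw_def 
proof (rule deriv_eq_on_greater[OF _ assms(2)])
  show "f_w p x w = LLw k p x w + NNv k p x" if "p < x" for x
    using f_w_eq[OF assms(1) that] .
  have "((\<lambda>x. NNv k p x) has_real_derivative NNpv k p v * 0 + NNvv k p v * 1) (at v)"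
    by (rule DERIV_NNv) (use assms in auto)
  then have N: "(NNv k p has_real_derivative NNvv k p v) (at v)" by simp
  have "((\<lambda>x. LLw k p x w) has_real_derivative LLvw k p v w * 1 + LLww p v * 0) (at v)"
    by (rule DERIV_LLw) (use assms in auto)
  then have L: "((\<lambda>x. LLw k p x w) has_real_derivative LLvw k p v w) (at v)" by simp
  show "((\<lambda>x. LLw k p x w + NNv k p x) has_real_derivative LLvw k p v w + NNvv k p v) (at v)"
    by (rule DERIV_add[OF L N])
qed

lemma f_vv_eq:
  assumes "0 \<le> p" "p < v"
  shows "f_vv p v w = LLvv k p v w + NNpvv k p v + NNvvv k p v * w"
  unfolding f_vv_def 
proof (rule deriv_eq_on_greater[OF _ assms(2)])
  show "f_v p x w = LLv k p x w + NNpv k p x + NNvv k p x * w" if "p < x" for x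
    using f_v_eq[OF assms(1) that] .
  have "((\<lambda>x. NNvv k p x) has_real_derivative NNpvv k p v * 0 + NNvvv k p v * 1) (at v)"
    by (rule DERIV_NNvv) (use assms in auto)
  then have N: "(NNvv k p has_real_derivative NNvvv k p v) (at v)" by simp
  have "((\<lambda>x. LLv k p x w) has_real_derivative LLvv k p v w * 1 + LLvw k p v w * 0) (at v)"
    by (rule DERIV_LLv) (use assms in auto)
  then have L: "((\<lambda>x. LLv k p x w) has_real_derivative LLvv k p v w) (at v)" by simp
  show "((\<lambda>x. LLv k p x w + NNpv k p x + NNvv k p x * w) has_real_derivative
    LLvv k p v w + NNpvv k p v + NNvvv k p v * w) (at v)"
    by (rule derivative_eq_intros L N DERIV_NNpv assms refl)+ simp
qed

text \<open>The null Lagrangian is affine in \<open>v'\<close> and contributes nothing here. Since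
  \<open>LLww\<close> is free of \<open>k\<close>, the proof may take \<open>k = 0\<close>.\<close>

lemma f_ww_eq:
  assumes "0 \<le> p" "p < v"
  shows "f_ww p v w = LLww p v"
proof -
  have "((\<lambda>y. LLw 0 p v y + NNv 0 p v) has_real_derivative LLww p v) (at w)"
    by (rule derivative_eq_intros DERIV_LLw[of "\<lambda>_. v" 0 _ _ "\<lambda>w. w" 1] assms refl | simp)+
  then show ?thesis
    unfolding f_ww_def f_w_eq[OF assms, where k = 0] by (rule DERIV_imp_deriv)
qed

section \<open>Scaled variables near the end point\<close>

definition ee :: "real \<Rightarrow> real" where "ee v = (3 * v\<^sup>2 - 1) / (2 * v^3 * (1 + v\<^sup>2)\<^sup>2)"

text \<open>It allows \<open>ee v - ee b\<close> to be written as \<open>v - b\<close> times a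
  factor that is continuous across \<open>v = b\<close>.\<close>

definition slope :: "(real \<Rightarrow> real) \<Rightarrow> real \<Rightarrow> real \<Rightarrow> real" where
  "slope F b v = (if v = b then deriv F b else (F v - F b) / (v - b))"

lemma slope_mult: "(v - b) * slope F b v = F v - F b"
  by (simp add: slope_def)

lemma continuous_on_slope:
  assumes "open A" "b \<in> A" "F field_differentiable at b" "continuous_on A F"
  shows "continuous_on A (slope F b)"
proof (rule continuous_at_imp_continuous_on, rule ballI)
  fix x assume x: "x \<in> A"
  show "isCont (slope F b) x"
  proof (cases "x = b")
    case True
    have "(F has_field_derivative deriv F b) (at b)"
      using assms(3) by (simp add: field_differentiable_derivI)
    then have "((\<lambda>v. (F v - F b) / (v - b)) \<longlongrightarrow> deriv F b) (at b)"
      by (simp add: has_field_derivative_iff)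
    then have "(slope F b \<longlongrightarrow> deriv F b) (at b)"
      by (rule Lim_transform_within[where d = 1]) (auto simp: slope_def)
    then show ?thesis using True by (simp add: isCont_def slope_def)
  next
    case False
    have "continuous_on (A - {b}) (\<lambda>v. (F v - F b) / (v - b))"
      by (intro continuous_intros continuous_on_subset[OF assms(4)]) auto
    then have "continuous_on (A - {b}) (slope F b)"
      by (rule continuous_on_eq) (auto simp: slope_def)
    then show ?thesis
      using x False assms(1) by (simp add: continuous_on_eq_continuous_at open_delete)
  qed
qed

lemma continuous_on_slope_ee:
  assumes "0 < b"
  shows "continuous_on {0<..} (slope ee b)"
proof (rule continuous_on_slope)
  have nz: "2 * v^3 * (1 + v\<^sup>2)\<^sup>2 \<noteq> 0" if "0 < v" for v :: real
    using that one_sq_pos[of v] by simp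
  show "ee field_differentiable at b"
    unfolding ee_def[abs_def] using nz[OF assms] by (intro derivative_intros) auto
  show "continuous_on {0<..} ee"
    unfolding ee_def[abs_def] using nz by (intro continuous_intros) auto
qed (use assms in auto)

section \<open>Continuity of the coefficient functions\<close>

lemma continuous_on_gg [continuous_intros]:
  "continuous_on S X \<Longrightarrow> continuous_on S (\<lambda>x. gg (X x))"
  unfolding gg_def by (intro continuous_intros) (simp_all add: one_sq_pos less_imp_neq[symmetric])
lemma continuous_on_gg1 [continuous_intros]:
  "continuous_on S X \<Longrightarrow> continuous_on S (\<lambda>x. gg1 (X x))"
  unfolding gg1_def by (intro continuous_intros) (simp_all add: one_sq_pos less_imp_neq[symmetric])
lemma continuous_on_gg2 [continuous_intros]:
  "continuous_on S X \<Longrightarrow> continuous_on S (\<lambda>x. gg2 (X x))"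
  unfolding gg2_def by (intro continuous_intros) (simp_all add: one_sq_pos less_imp_neq[symmetric])

context
  fixes S :: "'a :: topological_space set" and X :: "'a \<Rightarrow> real"
  assumes X: "continuous_on S X" and pos: "\<And>x. x \<in> S \<Longrightarrow> 0 < X x"
begin

lemma continuous_on_mm: "continuous_on S (\<lambda>x. mm (X x))"
  unfolding mm_def by (intro continuous_intros X) (use v_cube_pos[OF pos] in force)
lemma continuous_on_mm1: "continuous_on S (\<lambda>x. mm1 (X x))"
  unfolding mm1_def by (intro continuous_intros X) (use v_cube_pos[OF pos] in force)
lemma continuous_on_mm2: "continuous_on S (\<lambda>x. mm2 (X x))"
  unfolding mm2_def by (intro continuous_intros X) (use v_cube_pos[OF pos] in force)+
lemma continuous_on_mm3: "continuous_on S (\<lambda>x. mm3 (X x))"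
  unfolding mm3_def by (intro continuous_intros X) (use v_cube_pos[OF pos] in force)+

context
  fixes P :: "'a \<Rightarrow> real"
  assumes P: "continuous_on S P" and nonneg: "\<And>x. x \<in> S \<Longrightarrow> 0 \<le> P x"
begin

lemma sum_nz: "x \<in> S \<Longrightarrow> X x + P x \<noteq> 0"
  using pos[of x] nonneg[of x] by auto

lemma continuous_on_qq: "continuous_on S (\<lambda>x. qq (P x) (X x))"
  unfolding qq_def by (intro continuous_intros X P continuous_on_mm) (use sum_nz in auto)
lemma continuous_on_qq1: "continuous_on S (\<lambda>x. qq1 (P x) (X x))"
  unfolding qq1_def by (intro continuous_intros X P continuous_on_mm continuous_on_mm1) (use sum_nz in auto)
lemma continuous_on_qq2: "continuous_on S (\<lambda>x. qq2 (P x) (X x))"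
  unfolding qq2_def by (intro continuous_intros X P continuous_on_mm continuous_on_mm1 continuous_on_mm2) (use sum_nz in auto)

end
end

text \<open>
  \<open>vs\<close> expresses \<open>v\<close> through \<open>z = (v - p)/s\<^sup>2\<close>, and \<open>us\<close>, \<open>Wsc\<close> are \<open>uu / s\<close> and \<open>WW / s\<^sup>2\<close>; the variable
  \<open>o'\<close> is \<open>(v' - 1)/s\<close>. All of them stay regular at \<open>p = b\<close>.
\<close>

definition vs :: "real \<Rightarrow> real \<Rightarrow> real \<Rightarrow> real" where "vs b p z = p + (b - p)\<^sup>2 * z"
definition us :: "real \<Rightarrow> real \<Rightarrow> real \<Rightarrow> real" where "us b p z = sqrt (z * (vs b p z + p))"
definition Ws :: "real \<Rightarrow> real \<Rightarrow> real \<Rightarrow> real" where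
  "Ws b p z = vs b p z * ((b - p) * z - 1) * slope ee b (vs b p z)
     + (b - p) * z * mm (vs b p z) / (2 * vs b p z * (vs b p z + p))"
definition Wsc :: "real \<Rightarrow> real \<Rightarrow> real \<Rightarrow> real \<Rightarrow> real" where
  "Wsc b p z o' = 2 * gg (vs b p z) * o'\<^sup>2 + o' * Ws b p z
     + z * (mm (vs b p z) / (vs b p z * (vs b p z + p)) - ee b)"

lemma vs_pos: "0 < b \<Longrightarrow> 0 \<le> p \<Longrightarrow> p \<le> b \<Longrightarrow> 0 < z \<Longrightarrow> 0 < vs b p z"
  unfolding vs_def by (cases "p = 0") (auto intro: add_pos_nonneg)

lemma us_pos: "0 < b \<Longrightarrow> 0 \<le> p \<Longrightarrow> p \<le> b \<Longrightarrow> 0 < z \<Longrightarrow> 0 < us b p z"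
  using vs_pos[of b p z] by (simp add: us_def)

lemma vs_gt: "p < b \<Longrightarrow> 0 < z \<Longrightarrow> p < vs b p z"
  by (simp add: vs_def)

lemma uu_vs: "p \<le> b \<Longrightarrow> uu p (vs b p z) = (b - p) * us b p z"
proof -
  assume "p \<le> b"
  have "(vs b p z)\<^sup>2 - p\<^sup>2 = (b - p)\<^sup>2 * (z * (vs b p z + p))"
    unfolding vs_def by algebra
  then show ?thesis using \<open>p \<le> b\<close> by (simp add: uu_def us_def real_sqrt_mult)
qed

text \<open>In terms of the reduced Lagrangian these identities say
  \<open>WWw (ee v) v v 1 = 0\<close> and \<open>WW k v v 1 = 0\<close>. They are the two
  cancellations at \<open>p = v\<close>, \<open>w = 1\<close> on which the scaling rests.\<close>

lemma mm1_eq: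
  assumes "0 < v"
  shows "mm1 v = - 4 * gg v - mm v / (2 * v) + v * ee v"
    and "mm1 v = - 2 * gg v - mm v / v"
proof -
  define D where "D = 1 + v\<^sup>2"
  have D: "0 < D" by (simp add: D_def one_sq_pos)
  have vD: "v + v^3 = v * D" by (simp add: D_def power2_eq_square power3_eq_cube algebra_simps)
  show "mm1 v = - 4 * gg v - mm v / (2 * v) + v * ee v"
    unfolding gg_def ee_def mm_def mm1_def vD D_def[symmetric] using assms D
    by (simp add: divide_simps) (simp add: D_def, algebra)
  show "mm1 v = - 2 * gg v - mm v / v"
    unfolding gg_def ee_def mm_def mm1_def vD D_def[symmetric] using assms D
    by (simp add: divide_simps) (simp add: D_def, algebra)
qed

text \<open>Each term carries a factor \<open>s = b - p\<close>: \<open>w - 1 = s * o'\<close>,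
  \<open>v - p = s^2 * z\<close>, and \<open>v - b = s * (s * z - 1)\<close> gives
  \<open>ee v - ee b\<close> a factor \<open>s\<close> through \<open>slope\<close>.\<close>

lemma WWw_scaled:
  assumes "0 < b" "0 \<le> p" "p \<le> b" "0 < z"
  shows "WWw (ee b) p (vs b p z) (1 + (b - p) * o') =
    (b - p) * (4 * gg (vs b p z) * o' + Ws b p z)"
proof -
  define v where "v = vs b p z"
  have v: "0 < v" and vp: "v + p > 0" using vs_pos[OF assms] assms by (auto simp: v_def)
  have e: "ee v = ee b + (b - p) * ((b - p) * z - 1) * slope ee b v"
    using slope_mult[of v b ee] by (simp add: v_def vs_def power2_eq_square algebra_simps)
  have z: "(b - p)\<^sup>2 * z = v - p" by (simp add: v_def vs_def)
  define c where "c = mm v / (2 * v * (v + p))"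
  have Ws: "Ws b p z = v * ((b - p) * z - 1) * slope ee b v + (b - p) * z * c"
    by (simp add: Ws_def v_def c_def)
  have "(b - p) * (4 * gg v * o' + Ws b p z) = 4 * gg v * ((b - p) * o') + v * (ee v - ee b)
     + c * ((b - p)\<^sup>2 * z)"
    unfolding Ws e by algebra
  also have "\<dots> = WWw (ee b) p v (1 + (b - p) * o')"
    unfolding WWw_def mm1_eq(1)[OF v] z qq_def c_def using v vp
    by (simp add: divide_simps) algebra
  finally show ?thesis by (simp add: v_def)
qed

text \<open>\<open>WW\<close> is quadratic in \<open>w\<close>. Expanded about \<open>w = 1\<close>,
  its constant term is a multiple of \<open>v - p = s^2 * z\<close>, its linear coefficient is of
  order \<open>s\<close> by the previous lemma, and \<open>w - 1 = s * o'\<close>; hence the common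
  factor \<open>s^2\<close>.\<close>

lemma WW_scaled:
  assumes "0 < b" "0 \<le> p" "p \<le> b" "0 < z"
  shows "WW (ee b) p (vs b p z) (1 + (b - p) * o') = (b - p)\<^sup>2 * Wsc b p z o'"
proof -
  define v where "v = vs b p z"
  define o1 where "o1 = (b - p) * o'"
  have v: "0 < v" and vp: "v + p > 0" using vs_pos[OF assms] assms by (auto simp: v_def)
  have z: "(b - p)\<^sup>2 * z = v - p" by (simp add: v_def vs_def)
  have W: "(b - p) * Ws b p z = WWw (ee b) p v 1"
    using WWw_scaled[OF assms, of 0] by (simp add: v_def)
  define c where "c = mm v / (v * (v + p))"
  have Wsc: "Wsc b p z o' = 2 * gg v * o'\<^sup>2 + o' * Ws b p z + z * (c - ee b)"
    by (simp add: Wsc_def v_def c_def)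
  have "(b - p)\<^sup>2 * Wsc b p z o' = 2 * gg v * o1\<^sup>2 + o1 * ((b - p) * Ws b p z)
     + ((b - p)\<^sup>2 * z) * (c - ee b)"
    unfolding Wsc o1_def by algebra
  also have "\<dots> = WW (ee b) p v (1 + o1)"
    unfolding W z WW_def WWw_def mm1_eq(2)[OF v] qq_def c_def using v vp
    by (simp add: divide_simps) algebra
  finally show ?thesis by (simp add: v_def o1_def)
qed


section \<open>Scaled second derivatives of \<Lambda>, regular up to \<open>p = b\<close>\<close>

definition LvvS :: "real \<Rightarrow> real \<times> real \<times> real \<Rightarrow> real" where
  "LvvS b = (\<lambda>(p, z, o'). - p\<^sup>2 * Wsc b p z o' / us b p z ^ 3
     + 2 * vs b p z * WWv (ee b) p (vs b p z) (1 + (b - p) * o') / us b p z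
     + (b - p)\<^sup>2 * us b p z * WWvv p (vs b p z) (1 + (b - p) * o'))"
definition LvwS :: "real \<Rightarrow> real \<times> real \<times> real \<Rightarrow> real" where
  "LvwS b = (\<lambda>(p, z, o'). vs b p z * (4 * gg (vs b p z) * o' + Ws b p z) / us b p z
     + (b - p) * us b p z * WWvw (ee b) p (vs b p z) (1 + (b - p) * o'))"
definition LwwS :: "real \<Rightarrow> real \<times> real \<times> real \<Rightarrow> real" where
  "LwwS b = (\<lambda>(p, z, o'). 4 * us b p z * gg (vs b p z))"

lemma LL_scaled:
  assumes "0 < b" "0 \<le> p" "p < b" "0 < z"
  shows "(b - p) * LLvv (ee b) p (vs b p z) (1 + (b - p) * o') = LvvS b (p, z, o')"
    and "LLvw (ee b) p (vs b p z) (1 + (b - p) * o') = LvwS b (p, z, o')"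
    and "LLww p (vs b p z) = (b - p) * LwwS b (p, z, o')"
proof -
  have u: "0 < us b p z" using us_pos assms by simp
  have uu: "uu p (vs b p z) = (b - p) * us b p z" using uu_vs assms by simp
  have vs_eq: "(b - p)\<^sup>2 * z = vs b p z - p"
    by (simp add: vs_def)
  have "(us b p z)\<^sup>2 = z * (vs b p z + p)"
    using vs_pos[of b p z] assms by (simp add: us_def)
  then have sq: "((b - p) * us b p z)\<^sup>2 = (vs b p z)\<^sup>2 - p\<^sup>2"
    by (simp add: power_mult_distrib) (use vs_eq in algebra)
  \<comment> \<open>Since \<open>u^2 - v^2 = - p^2\<close>, the coefficient
    \<open>1/u - v^2/u^3\<close> equals \<open>- p^2/u^3\<close>, of order \<open>s^-3\<close>; the
    factor \<open>s^2\<close> of \<open>WW\<close> reduces this to order \<open>1/s\<close>.\<close>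
  have c: "(b - p) * (1 / ((b - p) * us b p z) - (vs b p z)\<^sup>2 / ((b - p) * us b p z) ^ 3) * (b - p)\<^sup>2
    = - p\<^sup>2 / us b p z ^ 3"
    using u assms(3) sq by (simp add: divide_simps) algebra
  have sW: "WW (ee b) p (vs b p z) (1 + (b - p) * o') = (b - p)\<^sup>2 * Wsc b p z o'"
    using WW_scaled assms by simp
  show "(b - p) * LLvv (ee b) p (vs b p z) (1 + (b - p) * o') = LvvS b (p, z, o')"
  proof -
    define s where "s = b - p"
    define a where "a = 1 / (s * us b p z) - (vs b p z)\<^sup>2 / (s * us b p z) ^ 3"
    define y where "y = vs b p z / (s * us b p z)"
    have y: "s * y = vs b p z / us b p z" using assms(3) by (simp add: s_def y_def)
    have "s * (a * (s\<^sup>2 * W) + 2 * y * Wv + s * us b p z * Wvv)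
      = s * a * s\<^sup>2 * W + 2 * (s * y) * Wv + s\<^sup>2 * us b p z * Wvv" for W Wv Wvv
      by algebra
    then show ?thesis
      unfolding LLvv_def LvvS_def uu sW y c[folded s_def a_def, folded s_def]
      unfolding s_def[symmetric] a_def[symmetric] y_def[symmetric]
      using y c by (simp add: s_def a_def)
  qed
  show "LLvw (ee b) p (vs b p z) (1 + (b - p) * o') = LvwS b (p, z, o')"
    unfolding LLvw_def LvwS_def uu using WWw_scaled[of b p z o'] assms u
    by simp
  show "LLww p (vs b p z) = (b - p) * LwwS b (p, z, o')"
    unfolding LLww_def LwwS_def uu by simp
qed

text \<open>The end point \<open>p = b\<close> is included although \<open>f\<close> is singular
  there: continuity of the scaled functions up to it provides bounds that are uniform in
  \<open>p\<close>.\<close>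

definition dom_s :: "real \<Rightarrow> (real \<times> real \<times> real) set" where
  "dom_s b = {(p, z, o'). 0 \<le> p \<and> p \<le> b \<and> 0 < z}"

context
  fixes b :: real
  assumes b: "0 < b"
begin

lemma continuous_on_vs: "continuous_on (dom_s b) (\<lambda>(p, z, o'). vs b p z)"
  unfolding vs_def case_prod_unfold by (intro continuous_intros)

lemma vs_pos': "x \<in> dom_s b \<Longrightarrow> 0 < (\<lambda>(p, z, o'). vs b p z) x"
  using vs_pos[OF b] by (auto simp: dom_s_def)

lemma dom_s_nonneg: "x \<in> dom_s b \<Longrightarrow> 0 \<le> fst x"
  by (auto simp: dom_s_def)

lemma continuous_on_us: "continuous_on (dom_s b) (\<lambda>(p, z, o'). us b p z)"
  using continuous_on_vs unfolding us_def case_prod_unfold by (intro continuous_intros)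

lemma us_nz: "x \<in> dom_s b \<Longrightarrow> us b (fst x) (fst (snd x)) \<noteq> 0"
  using us_pos[OF b] by (force simp: dom_s_def)

lemmas continuous_on_scaled =
  continuous_on_vs[unfolded case_prod_unfold] continuous_on_us[unfolded case_prod_unfold]
  continuous_on_mm[OF continuous_on_vs vs_pos', unfolded case_prod_unfold]
  continuous_on_mm1[OF continuous_on_vs vs_pos', unfolded case_prod_unfold]
  continuous_on_mm2[OF continuous_on_vs vs_pos', unfolded case_prod_unfold]
  continuous_on_mm3[OF continuous_on_vs vs_pos', unfolded case_prod_unfold]
  continuous_on_qq[OF continuous_on_vs vs_pos' continuous_on_fst[OF continuous_on_id] dom_s_nonneg,
    unfolded case_prod_unfold]
  continuous_on_qq1[OF continuous_on_vs vs_pos' continuous_on_fst[OF continuous_on_id] dom_s_nonneg,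
    unfolded case_prod_unfold]
  continuous_on_qq2[OF continuous_on_vs vs_pos' continuous_on_fst[OF continuous_on_id] dom_s_nonneg,
    unfolded case_prod_unfold]

lemma continuous_on_slope_vs:
  "continuous_on (dom_s b) (\<lambda>x. slope ee b (vs b (fst x) (fst (snd x))))"
  by (rule continuous_on_compose2[OF continuous_on_slope_ee[OF b] continuous_on_scaled(1)])
    (use vs_pos' in \<open>auto simp: case_prod_unfold\<close>)

lemma vs_nz: "x \<in> dom_s b \<Longrightarrow> vs b (fst x) (fst (snd x)) \<noteq> 0"
  using vs_pos'[of x] by (auto simp: case_prod_unfold)

lemma vs_add_nz: "x \<in> dom_s b \<Longrightarrow> vs b (fst x) (fst (snd x)) + fst x \<noteq> 0"
  using vs_pos'[of x] dom_s_nonneg[of x] by (auto simp: case_prod_unfold)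

lemma continuous_on_Ws: "continuous_on (dom_s b) (\<lambda>x. Ws b (fst x) (fst (snd x)))"
  unfolding Ws_def
  by (intro continuous_intros continuous_on_scaled continuous_on_slope_vs)
    (simp_all add: vs_nz vs_add_nz)

lemma continuous_on_LvvS: "continuous_on (dom_s b) (LvvS b)"
  unfolding LvvS_def case_prod_unfold Wsc_def WWv_def WWvv_def
  by (intro continuous_intros continuous_on_scaled continuous_on_Ws)
    (simp_all add: vs_nz vs_add_nz us_nz)

lemma continuous_on_LvwS: "continuous_on (dom_s b) (LvwS b)"
  unfolding LvwS_def case_prod_unfold WWvw_def
  by (intro continuous_intros continuous_on_scaled continuous_on_Ws)
    (simp_all add: us_nz)

lemma continuous_on_LwwS: "continuous_on (dom_s b) (LwwS b)"
  unfolding LwwS_def case_prod_unfold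
  by (intro continuous_intros continuous_on_scaled)

section \<open>Growth of \<open>N\<close>, its derivatives, \<open>LLw\<close> and \<open>f\<close>
  at the end point\<close>

definition NNS :: "real \<times> real \<times> real \<Rightarrow> real" where
  "NNS = (\<lambda>(p, z, o'). - us b p z * mm (vs b p z) + ee b / 3 * (b - p)\<^sup>2 * us b p z ^ 3)"
definition NNvS :: "real \<times> real \<times> real \<Rightarrow> real" where
  "NNvS = (\<lambda>(p, z, o'). - vs b p z / us b p z * mm (vs b p z)
     + (b - p)\<^sup>2 * us b p z * (ee b * vs b p z - mm1 (vs b p z)))"
definition NNvvS :: "real \<times> real \<times> real \<Rightarrow> real" where
  "NNvvS = (\<lambda>(p, z, o'). ((vs b p z)\<^sup>2 / us b p z ^ 3 - (b - p)\<^sup>2 / us b p z) * mm (vs b p z)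
     - 2 * (b - p)\<^sup>2 * vs b p z / us b p z * mm1 (vs b p z)
     + (b - p)^4 * us b p z * (ee b - mm2 (vs b p z))
     + ee b * (b - p)\<^sup>2 * (vs b p z)\<^sup>2 / us b p z)"
definition LLwS :: "real \<times> real \<times> real \<Rightarrow> real" where
  "LLwS = (\<lambda>(p, z, o'). (b - p)\<^sup>2 * us b p z * (4 * gg (vs b p z) * o' + Ws b p z))"
definition fS :: "real \<times> real \<times> real \<Rightarrow> real" where
  "fS = (\<lambda>(p, z, o'). 2 * (b - p) * us b p z * gg (vs b p z) * (1 + (b - p) * o')\<^sup>2
     - (p * o' - (b - p) * z) * mm (vs b p z) / us b p z)"

text \<open>As the scaled functions are continuous up to \<open>p = b\<close>, these equations give
  the orders \<open>s\<close>, \<open>1/s\<close>, \<open>1/s^3\<close> for \<open>NN\<close>,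
  \<open>NNv\<close>, \<open>NNvv\<close>, the order \<open>s^2\<close> for \<open>LLw\<close>, and
  boundedness of \<open>f\<close>. They serve to bound \<open>T\<close> near \<open>b\<close> and to
  integrate \<open>f\<close>.\<close>

lemma scaled_eqs:
  assumes "0 \<le> p" "p < b" "0 < z"
  shows "NN (ee b) p (vs b p z) = (b - p) * NNS (p, z, o')"
    and "(b - p) * NNv (ee b) p (vs b p z) = NNvS (p, z, o')"
    and "(b - p) ^ 3 * NNvv (ee b) p (vs b p z) = NNvvS (p, z, o')"
    and "LLw (ee b) p (vs b p z) (1 + (b - p) * o') = LLwS (p, z, o')"
    and "f p (vs b p z) (1 + (b - p) * o') = fS (p, z, o')"
proof -
  have u: "0 < us b p z" using us_pos b assms by simp
  have v: "0 < vs b p z" using vs_pos b assms by simp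
  have uu: "uu p (vs b p z) = (b - p) * us b p z" using uu_vs assms by simp
  have m: "mm (vs b p z) = 1 / (vs b p z * (1 + (vs b p z)\<^sup>2))"
    by (simp add: mm_def power2_eq_square power3_eq_cube algebra_simps)
  show "NN (ee b) p (vs b p z) = (b - p) * NNS (p, z, o')"
  proof -
    have "- (s * U) * m + k / 3 * (s * U) ^ 3 = s * (- U * m + k / 3 * s\<^sup>2 * U ^ 3)"
      for s U m k :: real
      by (simp add: algebra_simps power2_eq_square power3_eq_cube)
    then show ?thesis unfolding NN_def NNS_def uu by simp
  qed
  show "(b - p) * NNv (ee b) p (vs b p z) = NNvS (p, z, o')"
  proof -
    define s where "s = b - p"
    define y where "y = vs b p z / (s * us b p z)"
    have y: "s * y = vs b p z / us b p z" using assms(2) by (simp add: s_def y_def)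
    have "s * (- y * m0 - s * us b p z * m1 + k * (s * us b p z) * V)
      = - (s * y) * m0 + s\<^sup>2 * us b p z * (k * V - m1)" for m0 m1 k V
      by algebra
    then show ?thesis
      unfolding NNv_def NNvS_def uu
      unfolding s_def[symmetric] y_def[symmetric] y by (simp add: s_def)
  qed
  show "(b - p) ^ 3 * NNvv (ee b) p (vs b p z) = NNvvS (p, z, o')"
  proof -
    define s where "s = b - p"
    define m0 where "m0 = mm (vs b p z)"
    define m1 where "m1 = mm1 (vs b p z)"
    define m2 where "m2 = mm2 (vs b p z)"
    define U where "U = us b p z"
    define V where "V = vs b p z"
    define k where "k = ee b"
    have pos: "s \<noteq> 0" "U \<noteq> 0" using u assms(2) by (auto simp: s_def U_def)
    have 1: "s^3 * (1 / (s * U)) = s\<^sup>2 / U" "s^3 * (V\<^sup>2 / (s * U)^3) = V\<^sup>2 / U^3"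
      "s^3 * (V / (s * U)) = s\<^sup>2 * V / U" "s^3 * (V\<^sup>2 / (s * U)) = s\<^sup>2 * V\<^sup>2 / U"
      using pos by (simp_all add: power2_eq_square power3_eq_cube)
    have "s^3 * (- (1 / (s * U) - V\<^sup>2 / (s * U)^3) * m0 - 2 * (V / (s * U)) * m1 - s * U * m2
      + k * (s * U + V\<^sup>2 / (s * U))) =
      - (s^3 * (1 / (s * U)) - s^3 * (V\<^sup>2 / (s * U)^3)) * m0 - 2 * (s^3 * (V / (s * U))) * m1
      - s^4 * U * m2 + k * (s^4 * U + s^3 * (V\<^sup>2 / (s * U)))"
      by algebra
    also have "\<dots> = (V\<^sup>2 / U^3 - s\<^sup>2 / U) * m0 - 2 * s\<^sup>2 * V / U * m1 + s^4 * U * (k - m2)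
      + k * s\<^sup>2 * V\<^sup>2 / U"
      unfolding 1 by (simp add: algebra_simps)
    finally show ?thesis
      unfolding NNvv_def NNvvS_def uu s_def U_def V_def m0_def m1_def m2_def k_def by simp
  qed
  show "LLw (ee b) p (vs b p z) (1 + (b - p) * o') = LLwS (p, z, o')"
    unfolding LLw_def LLwS_def uu using WWw_scaled[OF b, of p z o'] assms
    by (simp add: power2_eq_square)
  have pv: "p * (1 + (b - p) * o') - vs b p z = (b - p) * (p * o' - (b - p) * z)"
    unfolding vs_def by algebra
  have "f p (vs b p z) (1 + (b - p) * o') = 2 * uu p (vs b p z) * gg (vs b p z) * (1 + (b - p) * o')\<^sup>2
     - (p * (1 + (b - p) * o') - vs b p z) * mm (vs b p z) / uu p (vs b p z)"
    unfolding f_def gg_def m uu_def[symmetric] by simp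
  then show "f p (vs b p z) (1 + (b - p) * o') = fS (p, z, o')"
    unfolding fS_def uu pv using u assms(2) by simp
qed

lemma continuous_on_NNS: "continuous_on (dom_s b) NNS"
  unfolding NNS_def case_prod_unfold
  by (intro continuous_intros continuous_on_scaled continuous_on_Ws) (simp_all add: us_nz)

lemma continuous_on_NNvS: "continuous_on (dom_s b) NNvS"
  unfolding NNvS_def case_prod_unfold
  by (intro continuous_intros continuous_on_scaled continuous_on_Ws) (simp_all add: us_nz)

lemma continuous_on_NNvvS: "continuous_on (dom_s b) NNvvS"
  unfolding NNvvS_def case_prod_unfold
  by (intro continuous_intros continuous_on_scaled continuous_on_Ws) (simp_all add: us_nz)

lemma continuous_on_LLwS: "continuous_on (dom_s b) LLwS"
  unfolding LLwS_def case_prod_unfold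
  by (intro continuous_intros continuous_on_scaled continuous_on_Ws)

lemma continuous_on_fS: "continuous_on (dom_s b) fS"
  unfolding fS_def case_prod_unfold
  by (intro continuous_intros continuous_on_scaled continuous_on_Ws) (simp_all add: us_nz)

end

section \<open>Second-order Taylor remainder\<close>

text \<open>A product of intervals is compact and convex: compactness gives uniform continuity,
  convexity keeps the intermediate point of Taylor's formula inside.\<close>

definition scaled_box :: "real \<Rightarrow> real \<Rightarrow> real \<Rightarrow> real \<Rightarrow> (real \<times> real \<times> real) set" where
  "scaled_box b z0 z1 w = {0..b} \<times> {z0..z1} \<times> {-w..w}"

lemma compact_scaled_box: "compact (scaled_box b z0 z1 w)"
  unfolding scaled_box_def by (intro compact_Times compact_Icc)

lemma scaled_box_subset: "0 < z0 \<Longrightarrow> scaled_box b z0 z1 w \<subseteq> dom_s b"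
  by (auto simp: scaled_box_def dom_s_def)

lemma bounded_on_box:
  fixes F :: "real \<times> real \<times> real \<Rightarrow> real"
  assumes "0 < z0" "continuous_on (dom_s b) F"
  obtains C where "0 < C" "\<And>x. x \<in> scaled_box b z0 z1 w \<Longrightarrow> \<bar>F x\<bar> \<le> C"
proof -
  have "bounded (F ` scaled_box b z0 z1 w)"
    by (intro compact_imp_bounded compact_continuous_image compact_scaled_box
        continuous_on_subset[OF assms(2)] scaled_box_subset assms(1))
  then show ?thesis using that by (auto simp: bounded_pos)
qed

lemma uniform_on_box:
  fixes F :: "real \<times> real \<times> real \<Rightarrow> real"
  assumes "0 < z0" "continuous_on (dom_s b) F" "0 < d"
  obtains e where "0 < e"
    "\<And>p z o' z' w'. \<lbrakk>(p, z, o') \<in> scaled_box b z0 z1 w; (p, z', w') \<in> scaled_box b z0 z1 w;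
       \<bar>z' - z\<bar> \<le> e; \<bar>w' - o'\<bar> \<le> e\<rbrakk> \<Longrightarrow> \<bar>F (p, z', w') - F (p, z, o')\<bar> \<le> d"
proof -
  have "uniformly_continuous_on (scaled_box b z0 z1 w) F"
    by (intro compact_uniformly_continuous compact_scaled_box
        continuous_on_subset[OF assms(2)] scaled_box_subset assms(1))
  then obtain e where e: "0 < e"
    "\<And>x x'. \<lbrakk>x \<in> scaled_box b z0 z1 w; x' \<in> scaled_box b z0 z1 w; dist x' x < e\<rbrakk> \<Longrightarrow> dist (F x') (F x) < d"
    using assms(3) unfolding uniformly_continuous_on_def by metis
  show ?thesis
  \<comment> \<open>\<open>p\<close> is common to both points, and two further coordinates differing
    by at most \<open>e / 3\<close> leave the distance strictly below \<open>e\<close>.\<close>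
  proof (rule that[of "e / 3"])
    fix p z o' z' w'
    assume in_box: "(p, z, o') \<in> scaled_box b z0 z1 w" "(p, z', w') \<in> scaled_box b z0 z1 w"
      and close: "\<bar>z' - z\<bar> \<le> e / 3" "\<bar>w' - o'\<bar> \<le> e / 3"
    have "dist (p, z', w') (p, z, o') \<le> \<bar>z' - z\<bar> + \<bar>w' - o'\<bar>"
      using sqrt_sum_squares_le_sum_abs[of "z' - z" "w' - o'"]
      by (simp add: dist_Pair_Pair dist_real_def)
    then show "\<bar>F (p, z', w') - F (p, z, o')\<bar> \<le> d"
      using e(2)[OF in_box] close e(1) by (simp add: dist_real_def)
  qed (use e(1) in simp)
qed

text \<open>Taylor's formula with Lagrange remainder for the restriction of \<Lambda> to the segment
  from \<open>(v, w)\<close> to \<open>(v + h, w + h')\<close>.\<close>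

lemma LL_taylor:
  assumes "0 \<le> p" "\<And>t. 0 \<le> t \<Longrightarrow> t \<le> 1 \<Longrightarrow> p < v + t * h"
  obtains t where "0 < t" "t < 1"
    "LL k p (v + h) (w + h') = LL k p v w + (LLv k p v w * h + LLw k p v w * h')
     + (LLvv k p (v + t * h) (w + t * h') * h\<^sup>2 + 2 * LLvw k p (v + t * h) (w + t * h') * h * h'
        + LLww p (v + t * h) * h'\<^sup>2) / 2"
proof -
  define F0 where "F0 t = LL k p (v + t * h) (w + t * h')" for t
  define F1 where "F1 t = LLv k p (v + t * h) (w + t * h') * h + LLw k p (v + t * h) (w + t * h') * h'" for t
  define F2 where "F2 t = LLvv k p (v + t * h) (w + t * h') * h\<^sup>2
    + 2 * LLvw k p (v + t * h) (w + t * h') * h * h' + LLww p (v + t * h) * h'\<^sup>2" for t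
  define diff where "diff m = (if m = (0::nat) then F0 else if m = 1 then F1 else F2)" for m
  have lin: "((\<lambda>t. a + t * c) has_real_derivative c) (at t)" for a c t :: real
    by (rule derivative_eq_intros refl | simp)+
  have D0: "(F0 has_real_derivative F1 t) (at t)" if "0 \<le> t" "t \<le> 1" for t
    unfolding F0_def[abs_def] F1_def
    by (rule DERIV_LL lin assms that)+
  have D1: "(F1 has_real_derivative F2 t) (at t)" if "0 \<le> t" "t \<le> 1" for t
    unfolding F1_def[abs_def] F2_def
    by (rule derivative_eq_intros DERIV_LLv DERIV_LLw lin assms that refl)+
      (simp add: power2_eq_square algebra_simps)
  have "\<exists>t. 0 < t \<and> t < 1 \<and> F0 1 = (\<Sum>m<2. diff m 0 / fact m * 1 ^ m) + diff 2 t / fact 2 * 1 ^ 2"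
  proof (rule Maclaurin)
    show "\<forall>m t. m < 2 \<and> 0 \<le> t \<and> t \<le> 1 \<longrightarrow> DERIV (diff m) t :> diff (Suc m) t"
      using D0 D1 by (auto simp: diff_def less_2_cases_iff)
  qed (auto simp: diff_def)
  then obtain t where "0 < t" "t < 1" "F0 1 = F0 0 + F1 0 + F2 t / 2"
    by (auto simp: diff_def numeral_2_eq_2)
  then show ?thesis
    by (intro that[of t]) (auto simp: F0_def F1_def F2_def)
qed

text \<open>With \<open>h = s^2 * x\<close> and \<open>h' = s * y\<close>, the weights
  \<open>1/s\<close>, \<open>1\<close>, \<open>s\<close> of the second derivatives all lead to the
  same factor \<open>s^3\<close>. Replacing the intermediate point by the base point then costs only
  the oscillation of the three scaled functions, which is at most \<open>d\<close> for small
  \<open>x\<close> and \<open>y\<close>.\<close>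

lemma LL_remainder:
  assumes b: "0 < b" and z0: "0 < z0" and d: "0 < d"
  obtains e where "0 < e"
    "\<And>p z o' x y. \<lbrakk>0 \<le> p; p < b; (p, z, o') \<in> scaled_box b z0 z1 w; (p, z + x, o' + y) \<in> scaled_box b z0 z1 w;
      \<bar>x\<bar> \<le> e; \<bar>y\<bar> \<le> e\<rbrakk> \<Longrightarrow>
      let v = vs b p z; w = 1 + (b - p) * o'; h = (b - p)\<^sup>2 * x; h' = (b - p) * y; k = ee b in
      LL k p (v + h) (w + h') - LL k p v w - (LLv k p v w * h + LLw k p v w * h')
       - (LLvv k p v w * h\<^sup>2 + 2 * LLvw k p v w * h * h' + LLww p v * h'\<^sup>2) / 2
      \<ge> - d * (b - p) ^ 3 * (x\<^sup>2 + y\<^sup>2)"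
proof -
  obtain e1 where e1: "0 < e1"
    "\<And>p z o' z' w'. \<lbrakk>(p, z, o') \<in> scaled_box b z0 z1 w; (p, z', w') \<in> scaled_box b z0 z1 w;
       \<bar>z' - z\<bar> \<le> e1; \<bar>w' - o'\<bar> \<le> e1\<rbrakk> \<Longrightarrow> \<bar>LvvS b (p, z', w') - LvvS b (p, z, o')\<bar> \<le> d"
    using uniform_on_box[OF z0 continuous_on_LvvS[OF b] d] by metis
  obtain e2 where e2: "0 < e2"
    "\<And>p z o' z' w'. \<lbrakk>(p, z, o') \<in> scaled_box b z0 z1 w; (p, z', w') \<in> scaled_box b z0 z1 w;
       \<bar>z' - z\<bar> \<le> e2; \<bar>w' - o'\<bar> \<le> e2\<rbrakk> \<Longrightarrow> \<bar>LvwS b (p, z', w') - LvwS b (p, z, o')\<bar> \<le> d"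
    using uniform_on_box[OF z0 continuous_on_LvwS[OF b] d] by metis
  obtain e3 where e3: "0 < e3"
    "\<And>p z o' z' w'. \<lbrakk>(p, z, o') \<in> scaled_box b z0 z1 w; (p, z', w') \<in> scaled_box b z0 z1 w;
       \<bar>z' - z\<bar> \<le> e3; \<bar>w' - o'\<bar> \<le> e3\<rbrakk> \<Longrightarrow> \<bar>LwwS b (p, z', w') - LwwS b (p, z, o')\<bar> \<le> d"
    using uniform_on_box[OF z0 continuous_on_LwwS[OF b] d] by metis
  show ?thesis
  proof (rule that[of "min e1 (min e2 e3)"])
    fix p z o' x y
    assume p: "0 \<le> p" "p < b" and B0: "(p, z, o') \<in> scaled_box b z0 z1 w"
      and B1: "(p, z + x, o' + y) \<in> scaled_box b z0 z1 w"
      and xy: "\<bar>x\<bar> \<le> min e1 (min e2 e3)" "\<bar>y\<bar> \<le> min e1 (min e2 e3)"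
    define s where "s = b - p"
    define k where "k = ee b"
    define v where "v = vs b p z"
    define w0 where "w0 = 1 + s * o'"
    define h where "h = s\<^sup>2 * x"
    define h' where "h' = s * y"
    have s: "0 < s" using p by (simp add: s_def)
    have Bt: "(p, z + t * x, o' + t * y) \<in> scaled_box b z0 z1 w" if "0 \<le> t" "t \<le> 1" for t
    proof -
      have conv: "l \<le> a + t * c \<and> a + t * c \<le> m" if "l \<le> a" "a \<le> m" "l \<le> a + c" "a + c \<le> m" for l a c m
      proof -
        have eq: "a + t * c = (1 - t) * a + t * (a + c)" by algebra
        have "(1 - t) * l + t * l \<le> a + t * c" "a + t * c \<le> (1 - t) * m + t * m"
          unfolding eq using that \<open>0 \<le> t\<close> \<open>t \<le> 1\<close> by (intro add_mono mult_left_mono; simp)+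
        then show ?thesis by (simp add: algebra_simps)
      qed
      show ?thesis using B0 B1 unfolding scaled_box_def
        using conv[of z0 z z1 x] conv[of "-w" o' w y] by auto
    qed
    have vt: "vs b p (z + t * x) = v + t * h" for t
      by (simp add: vs_def v_def h_def s_def algebra_simps)
    have wt: "1 + (b - p) * (o' + t * y) = w0 + t * h'" for t
      by (simp add: w0_def h'_def s_def algebra_simps)
    have zt: "0 < z + t * x" if "0 \<le> t" "t \<le> 1" for t
      using Bt[OF that] z0 by (auto simp: scaled_box_def)
    have gt: "p < v + t * h" if "0 \<le> t" "t \<le> 1" for t
      unfolding vt[symmetric] by (rule vs_gt[OF p(2) zt[OF that]])
    obtain t where t: "0 < t" "t < 1" and eq:
      "LL k p (v + h) (w0 + h') = LL k p v w0 + (LLv k p v w0 * h + LLw k p v w0 * h')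
       + (LLvv k p (v + t * h) (w0 + t * h') * h\<^sup>2 + 2 * LLvw k p (v + t * h) (w0 + t * h') * h * h'
          + LLww p (v + t * h) * h'\<^sup>2) / 2"
      by (rule LL_taylor[OF p(1) gt, of k w0 h'])
    have tx: "\<bar>t * x\<bar> \<le> \<bar>x\<bar>" "\<bar>t * y\<bar> \<le> \<bar>y\<bar>"
      using t by (simp_all add: abs_mult mult_left_le_one_le)
    have Bt': "(p, z + t * x, o' + t * y) \<in> scaled_box b z0 z1 w" using Bt t by simp
    define a1 where "a1 = LvvS b (p, z + t * x, o' + t * y) - LvvS b (p, z, o')"
    define a2 where "a2 = LvwS b (p, z + t * x, o' + t * y) - LvwS b (p, z, o')"
    define a3 where "a3 = LwwS b (p, z + t * x, o' + t * y) - LwwS b (p, z, o')"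
    have a: "\<bar>a1\<bar> \<le> d" "\<bar>a2\<bar> \<le> d" "\<bar>a3\<bar> \<le> d"
      unfolding a1_def a2_def a3_def using tx xy
      by (auto intro!: e1(2)[OF B0 Bt'] e2(2)[OF B0 Bt'] e3(2)[OF B0 Bt'])
    have zz: "0 < z" "0 < z + t * x" using zt[of 0] zt[of t] t by auto
    note sc0 = LL_scaled[OF b p zz(1), of o', folded s_def k_def v_def, folded w0_def]
    note sct = LL_scaled[OF b p zz(2), of "o' + t * y", unfolded vt wt, folded s_def k_def]
    have vv: "(LLvv k p (v + t * h) (w0 + t * h') - LLvv k p v w0) * h\<^sup>2 = s ^ 3 * a1 * x\<^sup>2"
    proof -
      have "s * (LLvv k p (v + t * h) (w0 + t * h') - LLvv k p v w0) = a1"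
        unfolding a1_def right_diff_distrib sct(1) sc0(1) ..
      moreover have "y * h\<^sup>2 = s ^ 3 * (s * y) * x\<^sup>2" for y
        unfolding h_def by algebra
      ultimately show ?thesis by metis
    qed
    have vw: "(LLvw k p (v + t * h) (w0 + t * h') - LLvw k p v w0) * h * h' = s ^ 3 * a2 * x * y"
    proof -
      have "LLvw k p (v + t * h) (w0 + t * h') - LLvw k p v w0 = a2"
        unfolding a2_def sct(2) sc0(2) ..
      moreover have "y * h * h' = s ^ 3 * y * x * z" if "h' = s * z" for y z
        unfolding h_def that by algebra
      ultimately show ?thesis using h'_def by metis
    qed
    have ww: "(LLww p (v + t * h) - LLww p v) * h'\<^sup>2 = s ^ 3 * a3 * y\<^sup>2"
    proof -
      have "LLww p (v + t * h) - LLww p v = s * a3"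
        unfolding a3_def sct(3) sc0(3) by (simp add: algebra_simps)
      moreover have "s * c * h'\<^sup>2 = s ^ 3 * c * y\<^sup>2" for c
        unfolding h'_def by algebra
      ultimately show ?thesis by metis
    qed
    \<comment> \<open>The mixed term is handled by \<open>2 * |x * y| \<le> x^2 + y^2\<close>. The
      total \<open>2 * d * (x^2 + y^2)\<close> loses its factor 2 to the 1/2 in Taylor's
      formula.\<close>
    have "\<bar>a1 * x\<^sup>2 + 2 * (a2 * (x * y)) + a3 * y\<^sup>2\<bar> \<le> d * x\<^sup>2 + d * (x\<^sup>2 + y\<^sup>2) + d * y\<^sup>2"
    proof -
      have "\<bar>a1 * x\<^sup>2\<bar> \<le> d * x\<^sup>2" "\<bar>a3 * y\<^sup>2\<bar> \<le> d * y\<^sup>2"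
        using a by (simp_all add: abs_mult mult_right_mono)
      moreover have "2 * \<bar>x * y\<bar> \<le> x\<^sup>2 + y\<^sup>2"
        using zero_le_power2[of "x - y"] zero_le_power2[of "x + y"]
        by (auto simp: power2_eq_square algebra_simps abs_if)
      then have "\<bar>2 * (a2 * (x * y))\<bar> \<le> d * (x\<^sup>2 + y\<^sup>2)"
        using mult_mono[OF a(2), of "2 * \<bar>x * y\<bar>" "x\<^sup>2 + y\<^sup>2"] d by (simp add: abs_mult mult.assoc)
      ultimately show ?thesis by linarith
    qed
    then have "- (2 * d * (x\<^sup>2 + y\<^sup>2)) \<le> a1 * x\<^sup>2 + 2 * (a2 * (x * y)) + a3 * y\<^sup>2"
      by (simp add: algebra_simps abs_le_iff)
    then have "s ^ 3 / 2 * - (2 * d * (x\<^sup>2 + y\<^sup>2)) \<le> s ^ 3 / 2 * (a1 * x\<^sup>2 + 2 * (a2 * (x * y)) + a3 * y\<^sup>2)"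
      using s by (intro mult_left_mono) auto
    also have "\<dots> = (s ^ 3 * a1 * x\<^sup>2 + 2 * (s ^ 3 * a2 * x * y) + s ^ 3 * a3 * y\<^sup>2) / 2"
      by (simp add: algebra_simps)
    also have "\<dots> = LL k p (v + h) (w0 + h') - LL k p v w0 - (LLv k p v w0 * h + LLw k p v w0 * h')
       - (LLvv k p v w0 * h\<^sup>2 + 2 * LLvw k p v w0 * h * h' + LLww p v * h'\<^sup>2) / 2"
      unfolding eq vv[symmetric] vw[symmetric] ww[symmetric]
      by (simp add: algebra_simps add_divide_distrib diff_divide_distrib)
    finally have "- d * s ^ 3 * (x\<^sup>2 + y\<^sup>2) \<le> \<dots>" by (simp add: algebra_simps)
    then show "let v = vs b p z; w = 1 + (b - p) * o'; h = (b - p)\<^sup>2 * x; h' = (b - p) * y; k = ee b in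
      LL k p (v + h) (w + h') - LL k p v w - (LLv k p v w * h + LLw k p v w * h')
       - (LLvv k p v w * h\<^sup>2 + 2 * LLvw k p v w * h * h' + LLww p v * h'\<^sup>2) / 2
      \<ge> - d * (b - p) ^ 3 * (x\<^sup>2 + y\<^sup>2)"
      unfolding Let_def s_def[symmetric] k_def[symmetric] v_def[symmetric] w0_def[symmetric]
        h_def[symmetric] h'_def[symmetric] .
  qed (use e1 e2 e3 in simp)
qed

section \<open>Functions on a compact interval\<close>

lemma D1_eq:
  assumes "0 < b" "p \<in> {0..b}" "(v has_real_derivative d) (at p within {0..b})"
  shows "D1 b v p = d"
  unfolding D1_def using assms
  by (intro vector_derivative_within_closed_interval) (simp_all add: has_real_derivative_iff_has_vector_derivative)

lemma DERIV_D1: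
  assumes "v differentiable (at p within {0..b})"
  shows "(v has_real_derivative D1 b v p) (at p within {0..b})"
  using assms unfolding D1_def has_real_derivative_iff_has_vector_derivative
  by (rule vector_derivative_works[THEN iffD1])

lemma C1_on_DERIV:
  "C1_on b v \<Longrightarrow> p \<in> {0..b} \<Longrightarrow> (v has_real_derivative D1 b v p) (at p within {0..b})"
  by (rule DERIV_D1) (auto simp: C1_on_def differentiable_on_def)

lemma at_within_Icc_interior: "p \<in> {0<..<b} \<Longrightarrow> at p within {0..b} = at p" for p :: real
  by (rule at_within_Icc_at) auto

lemma C1_on_DERIV_at:
  "C1_on b v \<Longrightarrow> p \<in> {0<..<b} \<Longrightarrow> (v has_real_derivative D1 b v p) (at p)"
  using C1_on_DERIV[of b v p] at_within_Icc_interior[of p b] by auto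

lemma dom2_DERIV:
  "p \<in> dom2 b v \<Longrightarrow> (D1 b v has_real_derivative D2 b v p) (at p within {0..b})"
  unfolding D2_def by (rule DERIV_D1) (simp add: dom2_def)

lemma C1_on_continuous: "C1_on b v \<Longrightarrow> continuous_on {0..b} v"
  by (auto simp: C1_on_def intro: differentiable_imp_continuous_on)

lemma D1_add:
  assumes "0 < b" "C1_on b v" "C1_on b h" "p \<in> {0..b}"
  shows "D1 b (\<lambda>x. v x + h x) p = D1 b v p + D1 b h p"
  by (rule D1_eq[OF assms(1,4)]) (intro DERIV_add C1_on_DERIV assms)

text \<open>A mean value inequality that tolerates finitely many exceptional points, needed because
  \<open>h''\<close> may fail to exist at corners of \<open>h'\<close>. It is proved by integrating
  the derivative.\<close>

lemma increment_le:
  fixes F F' :: "real \<Rightarrow> real"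
  assumes "a \<le> b" "finite S" "continuous_on {a..b} F" "0 \<le> M"
    and "\<And>x. x \<in> {a<..<b} - S \<Longrightarrow> (F has_real_derivative F' x) (at x)"
    and "\<And>x. x \<in> {a<..<b} - S \<Longrightarrow> \<bar>F' x\<bar> \<le> M"
  shows "\<bar>F b - F a\<bar> \<le> M * (b - a)"
proof -
  have "(F' has_integral (F b - F a)) {a..b}"
    using assms by (intro fundamental_theorem_of_calculus_interior_strong[of S])
      (auto simp: has_real_derivative_iff_has_vector_derivative)
  then have "norm (F b - F a) \<le> M * measure lborel (cbox a b)"
    using assms by (intro has_integral_bound_spike_finite[of M "S \<union> {a, b}" F']) auto
  then show ?thesis using assms(1) by simp
qed

text \<open>Both \<open>h\<close> and \<open>h'\<close> vanish at \<open>b\<close>, so integrating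
  the bound on \<open>h''\<close> from \<open>b\<close> backwards yields one power of
  \<open>b - p\<close> for \<open>h'\<close> and two for \<open>h\<close>; these are exactly the
  scales of \<open>v' - 1\<close> and \<open>v - p\<close>.\<close>

lemma PC2_small:
  assumes "PC2 b h" "h b = 0" "D1 b h b = 0" "0 \<le> \<epsilon>"
    and "\<And>p. p \<in> dom2 b h \<Longrightarrow> \<bar>D2 b h p\<bar> \<le> \<epsilon>" and p: "p \<in> {0..b}"
  shows "\<bar>D1 b h p\<bar> \<le> \<epsilon> * (b - p)" and "\<bar>h p\<bar> \<le> \<epsilon> * (b - p)\<^sup>2"
proof -
  obtain S where S: "finite S" "{0..b} - S \<subseteq> dom2 b h" using assms(1) by (auto simp: PC2_def)
  have C1: "C1_on b h" using assms(1) by (simp add: PC2_def)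
  have *: "\<bar>D1 b h q\<bar> \<le> \<epsilon> * (b - q)" if "q \<in> {0..b}" for q
  proof -
    have "\<bar>D1 b h b - D1 b h q\<bar> \<le> \<epsilon> * (b - q)"
    proof (rule increment_le[where S = S and F' = "D2 b h"])
      show "continuous_on {q..b} (D1 b h)"
        using C1 that by (auto simp: C1_on_def elim: continuous_on_subset)
      fix x assume x: "x \<in> {q<..<b} - S"
      then have "x \<in> dom2 b h" "x \<in> {0<..<b}" using S that by auto
      then show "(D1 b h has_real_derivative D2 b h x) (at x)" "\<bar>D2 b h x\<bar> \<le> \<epsilon>"
        using dom2_DERIV[of x b h] at_within_Icc_interior[of x b] assms(5) by auto
    qed (use that S assms in auto)
    then show ?thesis using assms(3) by simp
  qed
  show "\<bar>D1 b h p\<bar> \<le> \<epsilon> * (b - p)" by (rule *[OF p])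
  \<comment> \<open>On \<open>{p..b}\<close> the bound for \<open>h'\<close> is replaced by its
    largest value \<open>\<epsilon> * (b - p)\<close>; the constant 1/2 is given away.\<close>
  have "\<bar>h b - h p\<bar> \<le> (\<epsilon> * (b - p)) * (b - p)"
  proof (rule increment_le[where S = "{}" and F' = "D1 b h"])
    show "continuous_on {p..b} h"
      using C1_on_continuous[OF C1] p by (auto elim: continuous_on_subset)
    fix x assume x: "x \<in> {p<..<b} - {}"
    then show "(h has_real_derivative D1 b h x) (at x)"
      using C1_on_DERIV_at[OF C1] p by auto
    have "\<epsilon> * (b - x) \<le> \<epsilon> * (b - p)" using x assms(4) by (intro mult_left_mono) auto
    then show "\<bar>D1 b h x\<bar> \<le> \<epsilon> * (b - p)" using *[of x] x p by auto
  qed (use p assms in auto)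
  then show "\<bar>h p\<bar> \<le> \<epsilon> * (b - p)\<^sup>2" using assms(2) by (simp add: power2_eq_square mult.assoc)
qed

text \<open>Where \<open>v\<close> is affine, \<open>v + h\<close> and \<open>h\<close> differ by an
  affine function, so \<open>h\<close> is convex there too and \<open>h'\<close> is nondecreasing.
  This is where convexity of \<open>v + h\<close> enters the first variation.\<close>

lemma affine_convex_D2_nonneg:
  assumes "0 < r" "r < b" "C1_on b h" "convex_on {0..b} (\<lambda>x. v x + h x)"
    and aff: "\<And>x. x \<in> {0..r} \<Longrightarrow> v x = c + d * x" and p: "p \<in> {0<..<r}" "p \<in> dom2 b h"
  shows "0 \<le> D2 b h p"
proof -
  define g where "g x = c + d * x + h x" for x
  have g: "convex_on {0..r} g"
  proof -
    have "convex_on {0..r} (\<lambda>x. v x + h x)"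
      using assms(2) by (intro convex_on_subset[OF assms(4)]) auto
    moreover have "v x + h x = g x" if "x \<in> {0..r}" for x
      using aff[OF that] by (simp add: g_def)
    ultimately show ?thesis
      unfolding convex_on_def by (smt (verit) convexD)
  qed
  have Dg: "(g has_real_derivative d + D1 b h x) (at x)" if "x \<in> {0<..<r}" for x
    unfolding g_def[abs_def] using C1_on_DERIV_at[OF assms(3), of x] that assms(2)
    by (auto intro!: derivative_eq_intros)
  have mono: "D1 b h x \<le> D1 b h y" if "x \<in> {0<..<r}" "y \<in> {0<..<r}" "x \<le> y" for x y
  proof (cases "x = y")
    case False
    have tan: "g y' - g x' \<ge> (d + D1 b h x') * (y' - x')"
      if "x' \<in> {0<..<r}" "y' \<in> {0<..<r}" for x' y'
      using that Dg[OF that(1)] g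
      by (intro convex_on_imp_above_tangent[of "{0..r}" g]) 
        (auto simp: interior_atLeastAtMost_real has_field_derivative_at_within)
    \<comment> \<open>The sum of the two tangent inequalities, at \<open>x\<close> and at
      \<open>y\<close>, is the monotonicity of the derivative; the slope \<open>d\<close>
      cancels.\<close>
    have "(D1 b h y - D1 b h x) * (y - x) \<ge> 0"
      using tan[OF that(1,2)] tan[OF that(2,1)] by (simp add: algebra_simps)
    then show ?thesis using that(3) False by (simp add: zero_le_mult_iff)
  qed simp
  have D: "(D1 b h has_real_derivative D2 b h p) (at p)"
    using dom2_DERIV[OF p(2)] at_within_Icc_interior[of p b] p assms(2) by auto
  show ?thesis
  proof (rule ccontr)
    assume "\<not> 0 \<le> D2 b h p"
    then obtain e where e: "0 < e" "\<And>x. 0 < x \<Longrightarrow> x < e \<Longrightarrow> D1 b h (p + x) < D1 b h p"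
      using DERIV_neg_dec_right[OF D] by (auto simp: not_le)
    define x where "x = min (e / 2) ((r - p) / 2)"
    have "0 < x" "x < e" "p + x < r" using e(1) p by (auto simp: x_def min_def field_simps)
    then show False using e(2)[of x] mono[of p "p + x"] p by auto
  qed
qed

text \<open>Termwise differentiation of the power series at \<open>b\<close>, carried out twice. It
  supplies \<open>u''(b)\<close> as a genuine derivative, which the operator \<open>deriv\<close>
  alone does not guarantee.\<close>

lemma real_analytic_on_deriv:
  assumes "real_analytic_on u A" "b \<in> A"
  obtains e where "0 < e" "\<And>y. \<bar>y - b\<bar> < e \<Longrightarrow> (u has_real_derivative deriv u y) (at y)"
    "(deriv u has_real_derivative deriv (deriv u) b) (at b)"
proof -
  obtain e a where e: "0 < e" and sums: "\<And>y. \<bar>y - b\<bar> < e \<Longrightarrow> (\<lambda>n. a n * (y - b) ^ n) sums u y"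
    using assms unfolding real_analytic_on_def by blast
  have summ: "summable (\<lambda>n. a n * x ^ n)" if "norm x < e" for x
    using sums[of "b + x"] that by (auto simp: sums_iff)
  have summ': "summable (\<lambda>n. diffs a n * x ^ n)" if "norm x < e" for x
    by (rule termdiff_converges[OF that summ])
  have ser: "((\<lambda>y. \<Sum>n. c n * (y - b) ^ n) has_real_derivative (\<Sum>n. diffs c n * (y - b) ^ n)) (at y)"
    if c: "\<And>x. norm x < e \<Longrightarrow> summable (\<lambda>n. c n * x ^ n)" and y: "\<bar>y - b\<bar> < e" for c :: "nat \<Rightarrow> real" and y
  proof -
    obtain K where K: "\<bar>y - b\<bar> < K" "K < e" using dense y by blast
    have "((\<lambda>x. \<Sum>n. c n * x ^ n) has_real_derivative (\<Sum>n. diffs c n * (y - b) ^ n)) (at (y - b))"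
      by (rule termdiffs_strong[OF c[of K]]) (use K in auto)
    moreover have "((\<lambda>y. y - b) has_real_derivative 1) (at y)"
      by (auto intro!: derivative_eq_intros)
    ultimately show ?thesis
      using DERIV_chain2 by fastforce
  qed
  define u1 where "u1 y = (\<Sum>n. diffs a n * (y - b) ^ n)" for y
  have opn: "open {y. \<bar>y - b\<bar> < e}"
    by (intro open_Collect_less continuous_intros)
  have D: "(u has_real_derivative u1 y) (at y)" if "\<bar>y - b\<bar> < e" for y
    by (rule has_field_derivative_transform_within_open[OF ser[OF summ that, folded u1_def] opn])
      (use that sums in \<open>auto simp: sums_iff\<close>)
  have d1: "deriv u y = u1 y" if "\<bar>y - b\<bar> < e" for y
    by (rule DERIV_imp_deriv[OF D[OF that]])
  have "(u1 has_real_derivative (\<Sum>n. diffs (diffs a) n * (b - b) ^ n)) (at b)"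
    using ser[OF summ', of b] e unfolding u1_def[abs_def] by simp
  then have "(deriv u has_real_derivative (\<Sum>n. diffs (diffs a) n * (b - b) ^ n)) (at b)"
    by (rule has_field_derivative_transform_within_open[OF _ opn]) (use e d1 in auto)
  then have "(deriv u has_real_derivative deriv (deriv u) b) (at b)"
    by (simp only: DERIV_imp_deriv)
  then show ?thesis using that[OF e] D d1 by metis
qed

text \<open>A bound of order \<open>n\<close> known only near \<open>b\<close> extends to the whole
  interval by compactness, as \<open>g\<close> is positive away from \<open>b\<close>.\<close>

lemma pos_lower_bound:
  fixes g :: "real \<Rightarrow> real"
  assumes "0 < b" "continuous_on {0..b} g" "\<And>p. p \<in> {0..<b} \<Longrightarrow> 0 < g p"
    and "0 < d" "0 < c" "\<And>p. p \<in> {0..b} \<Longrightarrow> b - d < p \<Longrightarrow> c * (b - p) ^ n \<le> g p"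
  obtains c' where "0 < c'" "\<And>p. p \<in> {0..<b} \<Longrightarrow> c' * (b - p) ^ n \<le> g p"
proof -
  \<comment> \<open>The \<open>min\<close> ensures \<open>0 \<in> K\<close>, so \<open>K\<close> is
    nonempty even if \<open>d > b\<close>.\<close>
  define K where "K = {0..b - min d b}"
  have "compact K" "K \<noteq> {}" "K \<subseteq> {0..b}"
    using assms(1,4) by (auto simp: K_def)
  then obtain x where x: "x \<in> K" "\<And>y. y \<in> K \<Longrightarrow> g x \<le> g y"
    using continuous_attains_inf[of K g] continuous_on_subset[OF assms(2)] by metis
  have gx: "0 < g x" using x(1) assms(1,3,4) by (auto simp: K_def)
  define c' where "c' = min c (g x / b ^ n)"
  have c': "0 < c'" using gx assms by (simp add: c'_def)
  moreover have "c' * (b - p) ^ n \<le> g p" if p: "p \<in> {0..<b}" for p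
  proof (cases "p \<in> K")
    case True
    have "c' * (b - p) ^ n \<le> g x / b ^ n * b ^ n"
      using p c' gx by (intro mult_mono power_mono) (auto simp: c'_def)
    then show ?thesis using x(2)[OF True] assms(1) by simp
  next
    case False
    then have "b - d < p" using p by (auto simp: K_def min_def split: if_splits)
    then have "c * (b - p) ^ n \<le> g p" using assms(6) p by auto
    moreover have "c' * (b - p) ^ n \<le> c * (b - p) ^ n"
      using p by (intro mult_right_mono) (auto simp: c'_def)
    ultimately show ?thesis by linarith
  qed
  ultimately show ?thesis using that by blast
qed

lemma upper_bound:
  fixes g :: "real \<Rightarrow> real"
  assumes "0 < b" "continuous_on {0..b} g"
    and "0 < d" "0 < c" "\<And>p. p \<in> {0..b} \<Longrightarrow> b - d < p \<Longrightarrow> g p \<le> c * (b - p) ^ n"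
  obtains c' where "0 < c'" "\<And>p. p \<in> {0..<b} \<Longrightarrow> g p \<le> c' * (b - p) ^ n"
proof -
  have "bounded (g ` {0..b})"
    by (intro compact_imp_bounded compact_continuous_image assms(2) compact_Icc)
  then obtain M where M: "0 < M" "\<And>p. p \<in> {0..b} \<Longrightarrow> \<bar>g p\<bar> \<le> M"
    by (auto simp: bounded_pos)
  define c' where "c' = max c (M / d ^ n)"
  have c': "0 < c'" using assms by (simp add: c'_def)
  moreover have "g p \<le> c' * (b - p) ^ n" if p: "p \<in> {0..<b}" for p
  proof (cases "b - d < p")
    case False
    have "M / d ^ n * d ^ n \<le> c' * (b - p) ^ n"
      using False p c' assms(3) M(1) by (intro mult_mono power_mono) (auto simp: c'_def)
    then show ?thesis using M(2)[of p] p assms(3) by simp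
  next
    case True
    then have "g p \<le> c * (b - p) ^ n" using assms(5) p by auto
    moreover have "c * (b - p) ^ n \<le> c' * (b - p) ^ n"
      using p by (intro mult_right_mono) (auto simp: c'_def)
    ultimately show ?thesis by linarith
  qed
  ultimately show ?thesis using that by blast
qed

section \<open>Bounds along the extremal\<close>

text \<open>At \<open>b\<close> the function \<open>v - p\<close> vanishes together with its first
  derivative, and its one-sided second derivative is \<open>a = u''(b) > 0\<close>; so it is
  comparable to \<open>s^2\<close>, and \<open>v' - 1\<close> is at most of order \<open>s\<close>.
  Positivity of \<open>a\<close> yields the lower bound \<open>z0\<close>, which keeps the scaled
  variable \<open>z\<close> away from the singularity at 0.\<close>

lemma singular_arc_bounds:
  assumes "0 < r" "r < b" and v: "C1_on b v" "\<And>p. p \<in> {0..<b} \<Longrightarrow> p < v p" "v b = b"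
    and D1b: "D1 b v b = 1" and sing: "singular_arc b r v"
  obtains z0 z1 w where "0 < z0" "0 < z1" "0 < w"
    "\<And>p. p \<in> {0..<b} \<Longrightarrow> z0 * (b - p)\<^sup>2 \<le> v p - p"
    "\<And>p. p \<in> {0..<b} \<Longrightarrow> v p - p \<le> z1 * (b - p)\<^sup>2"
    "\<And>p. p \<in> {0..<b} \<Longrightarrow> \<bar>D1 b v p - 1\<bar> \<le> w * (b - p)"
proof -
  have b: "0 < b" using assms by simp
  obtain A u where u: "{r..b} \<subseteq> A" "real_analytic_on u A" "deriv u b = 1"
    "0 < deriv (deriv u) b" "\<And>p. p \<in> {r..b} \<Longrightarrow> v p = u p"
    using sing unfolding singular_arc_def by blast
  define a where "a = deriv (deriv u) b"
  have a: "0 < a" using u by (simp add: a_def)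
  have bA: "b \<in> A" using u(1) assms(2) by auto
  obtain e where e: "0 < e" and Du: "\<And>y. \<bar>y - b\<bar> < e \<Longrightarrow> (u has_real_derivative deriv u y) (at y)"
    and D2u: "(deriv u has_real_derivative a) (at b)"
    using real_analytic_on_deriv[OF u(2) bA] unfolding a_def by metis
  have "(\<lambda>p. (deriv u p - 1) / (p - b)) \<midarrow>b\<rightarrow> a"
    using D2u u(3) by (simp add: has_field_derivative_iff)
  moreover have "0 < a / 2" using a by simp
  ultimately obtain d0 where d0: "0 < d0"
    "\<And>p. p \<noteq> b \<Longrightarrow> \<bar>p - b\<bar> < d0 \<Longrightarrow> \<bar>(deriv u p - 1) / (p - b) - a\<bar> < a / 2"
    unfolding LIM_eq real_norm_def by meson
  define d where "d = min (min d0 e) (b - r)"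
  have d: "0 < d" "d \<le> d0" "d \<le> e" "d \<le> b - r" using d0 e assms by (auto simp: d_def)
  have D1v: "D1 b v p = deriv u p" if "b - d < p" "p < b" for p
  proof -
    have "(u has_real_derivative deriv u p) (at p)" using that d by (intro Du) auto
    then have "(v has_real_derivative deriv u p) (at p)"
      by (rule has_field_derivative_transform_within_open[of _ _ _ "{r<..<b}"])
        (use that d u(5) in auto)
    then show ?thesis
      using that d assms by (intro D1_eq) (auto intro: has_field_derivative_at_within)
  qed
  have slope: "a / 2 * (b - p) \<le> 1 - D1 b v p \<and> 1 - D1 b v p \<le> 3 * a / 2 * (b - p)"
    if "b - d < p" "p < b" for p
  proof -
    have *: "\<bar>(deriv u p - 1) / (p - b) - a\<bar> < a / 2"
      using that d by (intro d0(2)) auto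
    have eq: "(deriv u p - 1) / (p - b) = (1 - deriv u p) / (b - p)"
      using minus_divide_divide[of "1 - deriv u p" "b - p"] by simp
    have "a / 2 \<le> (1 - deriv u p) / (b - p)" "(1 - deriv u p) / (b - p) \<le> 3 * a / 2"
      using * unfolding eq by linarith+
    then show ?thesis using that by (simp add: D1v le_divide_eq divide_le_eq)
  qed
  have cv: "continuous_on {0..b} v" by (rule C1_on_continuous[OF v(1)])
  have Dz: "((\<lambda>q. c * (b - q)\<^sup>2 - (v q - q)) has_real_derivative (1 - D1 b v q - 2 * c * (b - q))) (at q)"
    if "q \<in> {0<..<b}" for q c
    by (rule derivative_eq_intros C1_on_DERIV_at[OF v(1) that] refl | simp add: algebra_simps)+
  \<comment> \<open>The functions \<open>c * (b - q)^2 - (v q - q)\<close> vanish at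
    \<open>b\<close> and are monotone for \<open>c = a / 4\<close> and \<open>c = 3 * a / 4\<close>,
    by the bounds on \<open>1 - v'\<close>.\<close>
  have sq: "a / 4 * (b - p)\<^sup>2 \<le> v p - p \<and> v p - p \<le> 3 * a / 4 * (b - p)\<^sup>2"
    if p: "b - d < p" "p \<in> {0..b}" for p
  proof -
    have p0: "0 < p" using p d assms by auto
    have cont: "continuous_on {p..b} (\<lambda>q. c * (b - q)\<^sup>2 - (v q - q))" for c
      using p by (intro continuous_intros continuous_on_subset[OF cv]) auto
    have "(a / 4) * (b - p)\<^sup>2 - (v p - p) \<le> (a / 4) * (b - b)\<^sup>2 - (v b - b)"
    proof (rule DERIV_nonneg_imp_increasing_open[OF _ _ cont])
      fix q assume q: "p < q" "q < b"
      then have "0 \<le> 1 - D1 b v q - 2 * (a / 4) * (b - q)"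
        using slope[of q] p by simp
      then show "\<exists>y. ((\<lambda>q. a / 4 * (b - q)\<^sup>2 - (v q - q)) has_real_derivative y) (at q) \<and> 0 \<le> y"
        using Dz[of q "a / 4"] q p0 by auto
    qed (use p in auto)
    moreover have "(3 * a / 4) * (b - p)\<^sup>2 - (v p - p) \<ge> (3 * a / 4) * (b - b)\<^sup>2 - (v b - b)"
    proof (rule DERIV_nonpos_imp_decreasing_open[OF _ _ cont])
      fix q assume q: "p < q" "q < b"
      then have "1 - D1 b v q - 2 * (3 * a / 4) * (b - q) \<le> 0"
        using slope[of q] p by simp
      then show "\<exists>y. ((\<lambda>q. 3 * a / 4 * (b - q)\<^sup>2 - (v q - q)) has_real_derivative y) (at q) \<and> y \<le> 0"
        using Dz[of q "3 * a / 4"] q p0 by auto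
    qed (use p in auto)
    ultimately show ?thesis using v(3) by simp
  qed
  have cz: "continuous_on {0..b} (\<lambda>p. v p - p)" by (intro continuous_intros cv)
  have cD: "continuous_on {0..b} (\<lambda>p. \<bar>D1 b v p - 1\<bar>)"
    using v(1) by (intro continuous_intros) (simp add: C1_on_def)
  obtain z0 where z0: "0 < z0" "\<And>p. p \<in> {0..<b} \<Longrightarrow> z0 * (b - p)\<^sup>2 \<le> v p - p"
    using pos_lower_bound[OF b cz _ d(1), of "a / 4" 2] a v(2) sq by auto
  obtain z1 where z1: "0 < z1" "\<And>p. p \<in> {0..<b} \<Longrightarrow> v p - p \<le> z1 * (b - p)\<^sup>2"
    using upper_bound[OF b cz d(1), of "3 * a / 4" 2] a sq by auto
  have "\<bar>D1 b v p - 1\<bar> \<le> 3 * a / 2 * (b - p) ^ 1" if "p \<in> {0..b}" "b - d < p" for p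
  proof (cases "p = b")
    case False
    then have "0 \<le> a / 2 * (b - p)" using that a by auto
    then show ?thesis using slope[of p] that False by auto
  qed (simp add: D1b)
  then obtain w where w: "0 < w" "\<And>p. p \<in> {0..<b} \<Longrightarrow> \<bar>D1 b v p - 1\<bar> \<le> w * (b - p) ^ 1"
    using upper_bound[OF b cD d(1), of "3 * a / 2" 1] a by auto
  show ?thesis using that[OF z0(1) z1(1) w(1) z0(2) z1(2)] w(2) by simp
qed

text \<open>Near \<open>b\<close> the values \<open>\<xi> b = 0\<close> and
  \<open>\<xi>' b = 1\<close> make \<open>|\<xi>|\<close> comparable to \<open>s\<close>; elsewhere
  the absence of conjugate points bounds it below. A single \<open>C\<close> serves for
  \<open>\<xi>\<close> and \<open>\<xi>'\<close>.\<close>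

lemma jacobi_bounds:
  assumes b: "0 < b" and C1: "C1_on b \<xi>" and "\<xi> b = 0" "D1 b \<xi> b = 1"
    and nz: "\<And>p. p \<in> {0..<b} \<Longrightarrow> \<xi> p \<noteq> 0"
  obtains c C where "0 < c" "0 < C"
    "\<And>p. p \<in> {0..<b} \<Longrightarrow> c * (b - p) \<le> \<bar>\<xi> p\<bar>"
    "\<And>p. p \<in> {0..<b} \<Longrightarrow> \<bar>\<xi> p\<bar> \<le> C * (b - p)"
    "\<And>p. p \<in> {0..<b} \<Longrightarrow> \<bar>D1 b \<xi> p\<bar> \<le> C"
proof -
  have cont: "continuous_on {0..b} \<xi>" by (rule C1_on_continuous[OF C1])
  have "bounded (D1 b \<xi> ` {0..b})"
    using C1 by (intro compact_imp_bounded compact_continuous_image compact_Icc) (simp add: C1_on_def)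
  then obtain C where C: "0 < C" "\<And>p. p \<in> {0..b} \<Longrightarrow> \<bar>D1 b \<xi> p\<bar> \<le> C"
    by (auto simp: bounded_pos)
  have up: "\<bar>\<xi> p\<bar> \<le> C * (b - p)" if p: "p \<in> {0..<b}" for p
  proof -
    have "\<bar>\<xi> b - \<xi> p\<bar> \<le> C * (b - p)"
      using p C C1_on_DERIV_at[OF C1] 
      by (intro increment_le[where S = "{}" and F' = "D1 b \<xi>"])
        (auto intro: continuous_on_subset[OF cont])
    then show ?thesis using assms(3) by simp
  qed
  have "((\<lambda>p. (\<xi> p - \<xi> b) / (p - b)) \<longlongrightarrow> 1) (at b within {0..b})"
    using C1_on_DERIV[OF C1, of b] b assms(4) by (simp add: has_field_derivative_iff)
  then have "\<forall>\<^sub>F p in at b within {0..b}. (\<xi> p - \<xi> b) / (p - b) > 1 / 2"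
    by (rule order_tendstoD) simp
  then obtain d where d: "0 < d"
    "\<And>p. p \<in> {0..b} \<Longrightarrow> p \<noteq> b \<Longrightarrow> \<bar>p - b\<bar> < d \<Longrightarrow> (\<xi> p - \<xi> b) / (p - b) > 1 / 2"
    unfolding eventually_at dist_real_def by blast
  have "1 / 2 * (b - p) ^ 1 \<le> \<bar>\<xi> p\<bar>" if p: "p \<in> {0..b}" "b - d < p" for p
  proof (cases "p = b")
    case False
    then have "(\<xi> p - \<xi> b) / (p - b) > 1 / 2" using d(2)[of p] p by auto
    then have "\<xi> p / (p - b) > 1 / 2" using assms(3) by simp
    then have "\<bar>\<xi> p / (p - b)\<bar> > 1 / 2" by (rule less_le_trans[OF _ abs_ge_self])
    then show ?thesis using False p by (simp add: abs_divide field_simps)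
  qed (use assms(3) in simp)
  then obtain c where "0 < c" "\<And>p. p \<in> {0..<b} \<Longrightarrow> c * (b - p) ^ 1 \<le> \<bar>\<xi> p\<bar>"
    using pos_lower_bound[OF b continuous_on_rabs[OF cont] _ d(1), of "1 / 2" 1] nz by auto
  then show ?thesis using that[of c C] C up by auto
qed

text \<open>The pointwise inequality behind the coercivity of the second variation: with
  \<open>h = q * x\<close> one has \<open>h' - h * x' / x = x * q'\<close>, and the left side is a
  constant times the derivative of \<open>s^2 * q^2\<close> when \<open>s' = - 1\<close>.
  Integrated, it combines Hardy's inequality with the absorption of the remainder.\<close>

lemma hardy_pointwise:
  fixes s x x' h h' A :: real
  assumes s: "0 < s" and "0 < c" "0 < C" "c * s \<le> \<bar>x\<bar>" "\<bar>x\<bar> \<le> C * s" "\<bar>x'\<bar> \<le> C"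
    and "0 < a" "a * s \<le> A" and d: "d = a * c\<^sup>2 / (12 * C\<^sup>2)"
  defines "q \<equiv> h / x" and "q' \<equiv> (h' * x - h * x') / x\<^sup>2"
  shows "a * c\<^sup>2 / 4 * (2 * s\<^sup>2 * q * q' - 2 * s * q\<^sup>2)
    \<le> A * (h' - h * x' / x)\<^sup>2 / 2 - d * (h\<^sup>2 / s + s * h'\<^sup>2)"
proof -
  have x: "x \<noteq> 0" using assms by (auto simp: mult_le_0_iff)
  define c0 where "c0 = a * c\<^sup>2"
  have c0: "0 < c0" using assms by (simp add: c0_def)
  have eq: "h' - h * x' / x = x * q'" "h = x * q" "h' = x' * q + x * q'"
    using x by (simp_all add: q_def q'_def field_simps power2_eq_square)
  have "0 < a * s" using assms by simp
  then have A: "0 \<le> A" using assms by linarith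
  have x2: "(c * s)\<^sup>2 \<le> x\<^sup>2" "x\<^sup>2 \<le> (C * s)\<^sup>2" "x'\<^sup>2 \<le> C\<^sup>2"
    using assms by (simp_all add: power2_le_iff_abs_le abs_le_square_iff[symmetric])
  have "c0 * s ^ 3 * q'\<^sup>2 = (a * s) * (c * s)\<^sup>2 * q'\<^sup>2"
    by (simp add: c0_def power2_eq_square power3_eq_cube)
  also have "\<dots> \<le> A * x\<^sup>2 * q'\<^sup>2"
    using assms x2 A by (intro mult_right_mono mult_mono) auto
  finally have 1: "c0 * s ^ 3 * q'\<^sup>2 \<le> A * (h' - h * x' / x)\<^sup>2"
    unfolding eq(1) by (simp add: power_mult_distrib mult.assoc)
  have "h\<^sup>2 / s \<le> (C * s)\<^sup>2 * q\<^sup>2 / s"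
    unfolding eq(2) power_mult_distrib using s x2 
    by (intro divide_right_mono mult_right_mono) (auto simp: power_mult_distrib)
  also have "\<dots> = C\<^sup>2 * (s * q\<^sup>2)" using s by (simp add: power2_eq_square)
  finally have 2: "h\<^sup>2 / s \<le> C\<^sup>2 * (s * q\<^sup>2)" .
  have "h'\<^sup>2 \<le> 2 * (x'\<^sup>2 * q\<^sup>2) + 2 * (x\<^sup>2 * q'\<^sup>2)"
    unfolding eq(3) using zero_le_power2[of "x' * q - x * q'"]
    by (simp add: power2_eq_square algebra_simps)
  also have "\<dots> \<le> 2 * (C\<^sup>2 * q\<^sup>2) + 2 * ((C * s)\<^sup>2 * q'\<^sup>2)"
    using x2 by (intro add_mono mult_left_mono mult_right_mono) auto
  finally have "s * h'\<^sup>2 \<le> s * (2 * (C\<^sup>2 * q\<^sup>2) + 2 * ((C * s)\<^sup>2 * q'\<^sup>2))"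
    using s by (intro mult_left_mono) auto
  then have 3: "s * h'\<^sup>2 \<le> 2 * C\<^sup>2 * (s * q\<^sup>2 + s ^ 3 * q'\<^sup>2)"
    by (simp add: power2_eq_square power3_eq_cube algebra_simps)
  have "0 \<le> C\<^sup>2 * (s ^ 3 * q'\<^sup>2)" using s by simp
  then have "h\<^sup>2 / s + s * h'\<^sup>2 \<le> 3 * C\<^sup>2 * (s * q\<^sup>2 + s ^ 3 * q'\<^sup>2)"
    using 2 3 by (simp add: algebra_simps)
  then have "d * (h\<^sup>2 / s + s * h'\<^sup>2) \<le> d * (3 * C\<^sup>2 * (s * q\<^sup>2 + s ^ 3 * q'\<^sup>2))"
    using assms by (intro mult_left_mono) auto
  \<comment> \<open>The choice of \<open>d\<close> amounts to
    \<open>3 * C^2 * d = a * c^2 / 4\<close>: half of the available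
    \<open>c0 / 2 * s^3 * q'^2\<close> pays for the remainder, the other half for Hardy's
    inequality.\<close>
  also have "d * (3 * C\<^sup>2 * x) = c0 / 4 * x" for x
  proof -
    have "d * (3 * C\<^sup>2) = c0 / 4" using \<open>0 < C\<close> by (simp add: c0_def d)
    then show ?thesis by (metis mult.assoc)
  qed
  finally have 4: "d * (h\<^sup>2 / s + s * h'\<^sup>2) \<le> c0 / 4 * (s * q\<^sup>2 + s ^ 3 * q'\<^sup>2)" .
  \<comment> \<open>Nonnegativity of \<open>s * (q - s * q')^2\<close> is the pointwise form of
    Hardy's inequality.\<close>
  have "0 \<le> c0 / 4 * (s * (q - s * q')\<^sup>2)" using c0 s by simp
  also have "s * (q - s * q')\<^sup>2 = s * q\<^sup>2 - 2 * s\<^sup>2 * q * q' + s ^ 3 * q'\<^sup>2"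
    by algebra
  finally show ?thesis using 1 4 unfolding c0_def[symmetric] by (simp add: algebra_simps)
qed

text \<open>In scaled variables \<open>f\<close> is \<open>fS\<close>, which is bounded on the box.
  So \<open>f\<close> is bounded and continuous along the curve on \<open>{0..<b}\<close>, and the
  single point \<open>b\<close> does not affect the integral.\<close>

lemma f_integrable:
  assumes b: "0 < b" and z0: "0 < z0" and y: "continuous_on {0..b} y" "continuous_on {0..b} w"
    and mem: "\<And>p. p \<in> {0..<b} \<Longrightarrow> (p, (y p - p) / (b - p)\<^sup>2, (w p - 1) / (b - p)) \<in> scaled_box b z0 z1 o1"
  shows "(\<lambda>p. f p (y p) (w p)) integrable_on {0..b}"
proof -
  obtain C where C: "0 < C" "\<And>x. x \<in> scaled_box b z0 z1 o1 \<Longrightarrow> \<bar>fS b x\<bar> \<le> C"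
    using bounded_on_box[OF z0 continuous_on_fS[OF b]] by metis
  have gt: "p < y p" if "p \<in> {0..<b}" for p
  proof -
    have "0 < (y p - p) / (b - p)\<^sup>2" using mem[OF that] z0 by (auto simp: scaled_box_def)
    then show ?thesis using that by (simp add: zero_less_divide_iff)
  qed
  have bound: "\<bar>f p (y p) (w p)\<bar> \<le> C" if p: "p \<in> {0..<b}" for p
  proof -
    have vs: "vs b p ((y p - p) / (b - p)\<^sup>2) = y p" using p by (simp add: vs_def)
    have ws: "1 + (b - p) * ((w p - 1) / (b - p)) = w p" using p by simp
    have "f p (y p) (w p) = fS b (p, (y p - p) / (b - p)\<^sup>2, (w p - 1) / (b - p))"
      using scaled_eqs(5)[OF b, of p "(y p - p) / (b - p)\<^sup>2" "(w p - 1) / (b - p)"] p gt[OF p]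
      unfolding vs ws by simp
    then show ?thesis using C(2)[OF mem[OF p]] by simp
  qed
  have "continuous_on {0..<b} (\<lambda>p. f p (y p) (w p))"
  proof -
    have nz: "y p * (1 + (y p)\<^sup>2) * sqrt ((y p)\<^sup>2 - p\<^sup>2) \<noteq> 0" "(1 + (y p)\<^sup>2)\<^sup>2 \<noteq> 0"
      if "p \<in> {0..<b}" for p
    proof -
      have "0 < y p" "p\<^sup>2 < (y p)\<^sup>2" using gt[OF that] that by (auto simp: power_strict_mono)
      then show "y p * (1 + (y p)\<^sup>2) * sqrt ((y p)\<^sup>2 - p\<^sup>2) \<noteq> 0" "(1 + (y p)\<^sup>2)\<^sup>2 \<noteq> 0"
        using one_sq_pos[of "y p"] by auto
    qed
    have y': "continuous_on {0..<b} y" and w': "continuous_on {0..<b} w"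
      using y by (auto intro: continuous_on_subset)
    show ?thesis
      unfolding f_def by (intro continuous_intros y' w' ballI nz)
  qed
  then have meas: "(\<lambda>p. f p (y p) (w p)) \<in> borel_measurable (lebesgue_on {0..<b})"
    by (rule continuous_imp_measurable_on_sets_lebesgue) simp
  have iff: "g integrable_on {0..b} \<longleftrightarrow> g integrable_on {0..<b}" for g :: "real \<Rightarrow> real"
    by (intro integrable_spike_set_eq negligible_subset[OF negligible_sing[of b]]) auto
  have "(\<lambda>_. C) integrable_on {0..<b}"
    unfolding iff[symmetric] by (rule integrable_const_ivl)
  then show ?thesis
    unfolding iff
    by (rule measurable_bounded_by_integrable_imp_integrable[OF meas]) (simp_all add: bound)
qed

section \<open>The second variation\<close>

text \<open>Jacobi's completion of the square. The left side is the derivative of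
  \<open>X * h^2 / (2 * x)\<close> for \<open>X = Fww * x' + Fvw * x\<close> when the Jacobi
  equation \<open>X' = Fvw * x' + Fvv * x\<close> holds.\<close>

lemma jacobi_square:
  fixes x x' h h' :: real
  assumes "x \<noteq> 0"
  shows "(Fvw * x' + Fvv * x) * h\<^sup>2 / (2 * x)
      + (Fww * x' + Fvw * x) * (2 * h * h' * x - h\<^sup>2 * x') / (2 * x\<^sup>2)
    = (Fvv * h\<^sup>2 + 2 * Fvw * h * h' + Fww * h'\<^sup>2) / 2 - Fww * (h' - h * x' / x)\<^sup>2 / 2"
  using assms by (simp add: divide_simps) algebra

text \<open>One fixed perturbation \<open>h\<close> of one extremal. The same box contains the
  scaled coordinates of \<open>v\<close> and of \<open>v + h\<close>; \<open>\<epsilon>\<close>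
  bounds both the scaled perturbation and the increments allowed in \<open>remainder\<close>;
  \<open>d\<close> is the constant of \<open>hardy_pointwise\<close>.\<close>

locale variation =
  fixes b r z0 z1 w0 \<epsilon> a c C d :: real and v h \<phi> \<psi> \<xi> :: "real \<Rightarrow> real" and S :: "real set"
  assumes r: "0 < r" "r < b" and z0: "0 < z0" and \<epsilon>: "0 < \<epsilon>"
    and C1v: "C1_on b v" and C1h: "C1_on b h"
    and mem: "\<And>p. p \<in> {0..<b} \<Longrightarrow> (p, (v p - p) / (b - p)\<^sup>2, (D1 b v p - 1) / (b - p)) \<in> scaled_box b z0 z1 w0"
    and mem_h: "\<And>p. p \<in> {0..<b} \<Longrightarrow> (p, (v p - p) / (b - p)\<^sup>2 + h p / (b - p)\<^sup>2,
        (D1 b v p - 1) / (b - p) + D1 b h p / (b - p)) \<in> scaled_box b z0 z1 w0"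
    and h_le: "\<And>p. p \<in> {0..<b} \<Longrightarrow> \<bar>h p\<bar> \<le> \<epsilon> * (b - p)\<^sup>2"
    and h'_le: "\<And>p. p \<in> {0..<b} \<Longrightarrow> \<bar>D1 b h p\<bar> \<le> \<epsilon> * (b - p)"
    and remainder: "\<And>p z o' x y. \<lbrakk>0 \<le> p; p < b; (p, z, o') \<in> scaled_box b z0 z1 w0;
      (p, z + x, o' + y) \<in> scaled_box b z0 z1 w0; \<bar>x\<bar> \<le> \<epsilon>; \<bar>y\<bar> \<le> \<epsilon>\<rbrakk> \<Longrightarrow>
      let v = vs b p z; w = 1 + (b - p) * o'; h = (b - p)\<^sup>2 * x; h' = (b - p) * y; k = ee b in
      LL k p (v + h) (w + h') - LL k p v w - (LLv k p v w * h + LLw k p v w * h')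
       - (LLvv k p v w * h\<^sup>2 + 2 * LLvw k p v w * h * h' + LLww p v * h'\<^sup>2) / 2
      \<ge> - d * (b - p) ^ 3 * (x\<^sup>2 + y\<^sup>2)"
    and a: "0 < a" "\<And>x. x \<in> scaled_box b z0 z1 w0 \<Longrightarrow> a \<le> LwwS b x"
    and d: "d = a * c\<^sup>2 / (12 * C\<^sup>2)"
    and c: "0 < c" "\<And>p. p \<in> {0..<b} \<Longrightarrow> c * (b - p) \<le> \<bar>\<xi> p\<bar>"
    and C: "0 < C" "\<And>p. p \<in> {0..<b} \<Longrightarrow> \<bar>\<xi> p\<bar> \<le> C * (b - p)"
      "\<And>p. p \<in> {0..<b} \<Longrightarrow> \<bar>D1 b \<xi> p\<bar> \<le> C"
    and C1\<xi>: "C1_on b \<xi>"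
    and jacobi: "\<And>p. p \<in> {0..<b} \<Longrightarrow>
        ((\<lambda>q. f_ww q (v q) (D1 b v q) * D1 b \<xi> q + f_vw q (v q) (D1 b v q) * \<xi> q)
           has_real_derivative
           (f_vw p (v p) (D1 b v p) * D1 b \<xi> p + f_vv p (v p) (D1 b v p) * \<xi> p))
        (at p within {0..<b})"
    and \<phi>: "\<And>p. p \<in> {0..<b} \<Longrightarrow>
      (\<phi> has_real_derivative f_v p (v p) (D1 b v p)) (at p within {0..<b})"
    and \<psi>: "\<And>p. p \<in> {0..<b} \<Longrightarrow>
      (\<psi> has_real_derivative (f_w p (v p) (D1 b v p) - \<phi> p)) (at p within {0..<b})"
    and \<psi>_0: "\<psi> 0 = 0" and \<psi>_r: "\<And>p. p \<in> {r..b} \<Longrightarrow> \<psi> p = 0" and \<psi>_le: "\<And>p. p \<in> {0..b} \<Longrightarrow> \<psi> p \<le> 0"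
    and h_0: "h 0 = 0"
    and S: "finite S" "r \<in> S"
    and h'': "\<And>p. p \<in> {0<..<b} - S \<Longrightarrow> (D1 b h has_real_derivative D2 b h p) (at p)"
    and h''_nonneg: "\<And>p. p \<in> {0<..<r} - S \<Longrightarrow> 0 \<le> D2 b h p"
begin

definition k where "k = ee b"
text \<open>The momentum of the Jacobi field; its derivative is prescribed by the Jacobi
  equation.\<close>

definition X where
  "X q = f_ww q (v q) (D1 b v q) * D1 b \<xi> q + f_vw q (v q) (D1 b v q) * \<xi> q"
definition R where
  "R p = NN k p (v p + h p) - NN k p (v p) - NNv k p (v p) * h p - NNvv k p (v p) * (h p)\<^sup>2 / 2"
definition H where "H p = a * c\<^sup>2 / 4 * (b - p)\<^sup>2 * (h p / \<xi> p)\<^sup>2"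
text \<open>
  \<open>T\<close> is the verification function: \<open>T' \<le> \<Delta>\<close>, \<open>T 0 = 0\<close> and \<open>T p \<rightarrow> 0\<close> as \<open>p \<rightarrow> b\<close>. The part \<open>H\<close> carries
  Hardy's inequality, and \<open>R\<close> compensates the third-order error of the null Lagrangian.
\<close>

definition T1 where "T1 p = \<phi> p * h p + X p * (h p)\<^sup>2 / (2 * \<xi> p) + R p + H p"
definition T where "T p = T1 p + \<psi> p * D1 b h p"
definition \<Delta> where "\<Delta> p = f p (v p + h p) (D1 b v p + D1 b h p) - f p (v p) (D1 b v p)"

definition R' where
  "R' p = NNp k p (v p + h p) + NNv k p (v p + h p) * (D1 b v p + D1 b h p)
    - NNp k p (v p) - NNv k p (v p) * D1 b v p
    - (NNpv k p (v p) + NNvv k p (v p) * D1 b v p) * h p - NNv k p (v p) * D1 b h p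
    - (NNpvv k p (v p) + NNvvv k p (v p) * D1 b v p) * (h p)\<^sup>2 / 2
    - NNvv k p (v p) * h p * D1 b h p"
definition H' where
  "H' p = a * c\<^sup>2 / 4 * (2 * (b - p)\<^sup>2 * (h p / \<xi> p) * ((D1 b h p * \<xi> p - h p * D1 b \<xi> p) / (\<xi> p)\<^sup>2)
    - 2 * (b - p) * (h p / \<xi> p)\<^sup>2)"
definition T1' where
  "T1' p = f_v p (v p) (D1 b v p) * h p + \<phi> p * D1 b h p
    + ((f_vw p (v p) (D1 b v p) * D1 b \<xi> p + f_vv p (v p) (D1 b v p) * \<xi> p) * (h p)\<^sup>2 / (2 * \<xi> p)
      + X p * (2 * h p * D1 b h p * \<xi> p - (h p)\<^sup>2 * D1 b \<xi> p) / (2 * (\<xi> p)\<^sup>2))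
    + R' p + H' p"

lemma b: "0 < b" using r by simp

lemma gt:
  assumes p: "p \<in> {0..<b}"
  shows "p < v p" "p < v p + h p"
proof -
  have "0 < (v p - p) / (b - p)\<^sup>2" "0 < (v p - p + h p) / (b - p)\<^sup>2"
    using mem[OF p] mem_h[OF p] z0 by (auto simp: scaled_box_def add_divide_distrib)
  then show "p < v p" "p < v p + h p" using p by (auto simp: zero_less_divide_iff)
qed

lemma \<xi>_nz: "p \<in> {0..<b} \<Longrightarrow> \<xi> p \<noteq> 0"
  using c(1) c(2)[of p] by (auto simp: mult_le_0_iff)

context
  fixes p assumes p: "p \<in> {0..<b}"
begin

lemma Dv: "(v has_real_derivative D1 b v p) (at p within {0..<b})"
  and Dh: "(h has_real_derivative D1 b h p) (at p within {0..<b})"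
  and D\<xi>: "(\<xi> has_real_derivative D1 b \<xi> p) (at p within {0..<b})"
  using p by (auto intro!: DERIV_subset[OF C1_on_DERIV] C1v C1h C1\<xi>)

lemma R_deriv: "(R has_real_derivative R' p) (at p within {0..<b})"
proof -
  have p0: "0 \<le> p" using p by simp
  have Dvh: "((\<lambda>p. v p + h p) has_real_derivative D1 b v p + D1 b h p) (at p within {0..<b})"
    by (intro DERIV_add Dv Dh)
  note N = DERIV_NN[where P = "\<lambda>x. x", OF DERIV_ident Dvh p0 gt(2)[OF p]]
    DERIV_NN[where P = "\<lambda>x. x", OF DERIV_ident Dv p0 gt(1)[OF p]]
    DERIV_NNv[where P = "\<lambda>x. x", OF DERIV_ident Dv p0 gt(1)[OF p]]
    DERIV_NNvv[where P = "\<lambda>x. x", OF DERIV_ident Dv p0 gt(1)[OF p]]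
  show ?thesis
    unfolding R_def[abs_def] R'_def
    by (rule derivative_eq_intros N Dh refl | simp)+ (simp add: algebra_simps power2_eq_square)
qed

lemma H_deriv: "(H has_real_derivative H' p) (at p within {0..<b})"
proof -
  have q: "((\<lambda>p. h p / \<xi> p) has_real_derivative (D1 b h p * \<xi> p - h p * D1 b \<xi> p) / (\<xi> p)\<^sup>2)
    (at p within {0..<b})"
    using DERIV_divide[OF Dh D\<xi> \<xi>_nz[OF p]] by (simp add: power2_eq_square)
  show ?thesis
    unfolding H_def[abs_def] H'_def
    by (rule derivative_eq_intros q refl | simp)+ (simp add: algebra_simps)
qed

lemma T1_deriv: "(T1 has_real_derivative T1' p) (at p within {0..<b})"
proof -
  have nz: "2 * \<xi> p \<noteq> 0" using \<xi>_nz[OF p] by simp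
  have DX: "(X has_real_derivative
      (f_vw p (v p) (D1 b v p) * D1 b \<xi> p + f_vv p (v p) (D1 b v p) * \<xi> p)) (at p within {0..<b})"
    using jacobi[OF p] unfolding X_def[abs_def] .
  have XX: "((\<lambda>p. X p * (h p)\<^sup>2 / (2 * \<xi> p)) has_real_derivative
    (f_vw p (v p) (D1 b v p) * D1 b \<xi> p + f_vv p (v p) (D1 b v p) * \<xi> p) * (h p)\<^sup>2 / (2 * \<xi> p)
      + X p * (2 * h p * D1 b h p * \<xi> p - (h p)\<^sup>2 * D1 b \<xi> p) / (2 * (\<xi> p)\<^sup>2)) (at p within {0..<b})"
    apply (rule derivative_eq_intros DX Dh D\<xi> nz refl)+
    using nz by (simp add: divide_simps) algebra
  show ?thesis
    unfolding T1_def[abs_def] T1'_def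
    by (rule derivative_eq_intros \<phi>[OF p] Dh XX R_deriv H_deriv refl)+ simp
qed

text \<open>The left side is \<open>T'\<close> without the term \<open>\<psi> * h''\<close>, which
  is undefined at corners of \<open>h'\<close> and is added later with its sign.
  \<open>\<phi>\<close> cancels and leaves the first variation, \<open>jacobi_square\<close>
  supplies the second, and \<open>hardy_pointwise\<close> absorbs the Taylor error bounded in
  \<open>remainder\<close>.\<close>

lemma T_deriv_le:
  "T1' p + (f_w p (v p) (D1 b v p) - \<phi> p) * D1 b h p \<le> \<Delta> p"
proof -
  define s where "s = b - p"
  define w h0 h' x x' where "w = D1 b v p" and "h0 = h p" and "h' = D1 b h p" and "x = \<xi> p" and "x' = D1 b \<xi> p"
  have s: "0 < s" using p by (simp add: s_def)
  have p0: "0 \<le> p" using p by simp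
  define L0 where "L0 = LLv k p (v p) w * h0 + LLw k p (v p) w * h'"
  define L1 where "L1 = (LLvv k p (v p) w * h0\<^sup>2 + 2 * LLvw k p (v p) w * h0 * h' + LLww p (v p) * h'\<^sup>2) / 2"
  note fs = f_v_eq[OF p0 gt(1)[OF p], of w k] f_w_eq[OF p0 gt(1)[OF p], of w k]
    f_vv_eq[OF p0 gt(1)[OF p], of w k] f_vw_eq[OF p0 gt(1)[OF p], of w k] f_ww_eq[OF p0 gt(1)[OF p], of w]
  have vs: "vs b p ((v p - p) / (b - p)\<^sup>2) = v p" "1 + s * ((w - 1) / s) = w"
    "s\<^sup>2 * (h0 / s\<^sup>2) = h0" "s * (h' / s) = h'"
    using s by (simp_all add: vs_def s_def)
  have s3: "s ^ 3 * ((h0 / s\<^sup>2)\<^sup>2 + (h' / s)\<^sup>2) = h0\<^sup>2 / s + s * h'\<^sup>2"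
    using s by (simp add: divide_simps) algebra
  have hs: "\<bar>h0 / s\<^sup>2\<bar> \<le> \<epsilon>" "\<bar>h' / s\<bar> \<le> \<epsilon>"
    using h_le[OF p] h'_le[OF p] s by (simp_all add: h0_def h'_def s_def abs_divide divide_le_eq)
  have "- d * (s ^ 3 * ((h0 / s\<^sup>2)\<^sup>2 + (h' / s)\<^sup>2)) \<le> LL k p (v p + h0) (w + h') - LL k p (v p) w - L0 - L1"
    using remainder[OF p0 _ mem[OF p] mem_h[OF p]] p hs
    unfolding s_def[symmetric] w_def[symmetric] h0_def[symmetric] h'_def[symmetric] k_def[symmetric]
      Let_def vs[unfolded s_def[symmetric]] L0_def L1_def vs(1)[folded s_def]
    by (simp add: mult.assoc)
  then have rem: "LL k p (v p + h0) (w + h') \<ge> LL k p (v p) w + L0 + L1 - d * (h0\<^sup>2 / s + s * h'\<^sup>2)"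
    unfolding s3 by simp
  have Lww: "a * s \<le> LLww p (v p)"
  proof -
    have "LLww p (v p) = s * LwwS b (p, (v p - p) / (b - p)\<^sup>2, (w - 1) / s)"
      using LL_scaled(3)[OF b p0, of "(v p - p) / (b - p)\<^sup>2" "(w - 1) / s"] p gt(1)[OF p] s
      unfolding vs s_def[symmetric] by (simp add: vs(1)[folded s_def])
    moreover have "a \<le> LwwS b (p, (v p - p) / (b - p)\<^sup>2, (w - 1) / s)"
      using a(2)[OF mem[OF p]] by (simp add: w_def s_def)
    ultimately show ?thesis using s by simp
  qed
  have hardy: "H' p \<le> LLww p (v p) * (h' - h0 * x' / x)\<^sup>2 / 2 - d * (h0\<^sup>2 / s + s * h'\<^sup>2)"
    unfolding H'_def s_def[symmetric] h0_def[symmetric] h'_def[symmetric] x_def[symmetric] x'_def[symmetric]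
    by (rule hardy_pointwise[OF s c(1) C(1) _ _ _ a(1) Lww d])
      (use c(2)[OF p] C(2,3)[OF p] in \<open>simp_all add: x_def x'_def s_def\<close>)
  have nz: "x \<noteq> 0" using \<xi>_nz[OF p] by (simp add: x_def)
  note sq = jacobi_square[OF nz, of "f_vw p (v p) w" x' "f_vv p (v p) w" h0 "f_ww p (v p) w" h']
  have T1': "T1' p = f_v p (v p) w * h0 + \<phi> p * h'
    + ((f_vv p (v p) w * h0\<^sup>2 + 2 * f_vw p (v p) w * h0 * h' + f_ww p (v p) w * h'\<^sup>2) / 2
       - f_ww p (v p) w * (h' - h0 * x' / x)\<^sup>2 / 2) + R' p + H' p"
    unfolding T1'_def X_def w_def[symmetric] h0_def[symmetric] h'_def[symmetric] x_def[symmetric]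
      x'_def[symmetric] sq ..
  have R': "R' p = NNp k p (v p + h0) + NNv k p (v p + h0) * (w + h')
    - NNp k p (v p) - NNv k p (v p) * w
    - (NNpv k p (v p) + NNvv k p (v p) * w) * h0 - NNv k p (v p) * h'
    - (NNpvv k p (v p) + NNvvv k p (v p) * w) * h0\<^sup>2 / 2 - NNvv k p (v p) * h0 * h'"
    unfolding R'_def w_def h0_def h'_def ..
  have \<Delta>: "\<Delta> p = LL k p (v p + h0) (w + h') + NNp k p (v p + h0) + NNv k p (v p + h0) * (w + h')
    - (LL k p (v p) w + NNp k p (v p) + NNv k p (v p) * w)"
    unfolding \<Delta>_def w_def h0_def h'_def
    by (simp add: f_eq[OF p0 gt(1)[OF p], where k = k] f_eq[OF p0 gt(2)[OF p], where k = k])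
  \<comment> \<open>Of \<open>N\<close> only the values of \<open>NNp\<close> and \<open>NNv\<close>
    at \<open>v\<close> and \<open>v + h\<close> survive, and they match the corresponding terms of
    \<open>\<Delta>\<close>; what is left is an inequality for \<Lambda>.\<close>
  have "T1' p + (f_w p (v p) w - \<phi> p) * h' = L0 + L1 + NNp k p (v p + h0) + NNv k p (v p + h0) * (w + h')
    - NNp k p (v p) - NNv k p (v p) * w - LLww p (v p) * (h' - h0 * x' / x)\<^sup>2 / 2 + H' p"
    unfolding T1' R' fs L0_def L1_def
    by (simp add: algebra_simps add_divide_distrib diff_divide_distrib)
  then show ?thesis
    unfolding \<Delta> w_def[symmetric] h'_def[symmetric] using rem hardy by linarith
qed

end


section \<open>Behaviour of \<open>T\<close> at the end point, along the singular arc\<close>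

definition bdd :: "(real \<Rightarrow> real) \<Rightarrow> bool" where
  "bdd g \<longleftrightarrow> (\<exists>M. \<forall>p\<in>{r<..<b}. \<bar>g p\<bar> \<le> M)"

lemma bddI: "(\<And>p. p \<in> {r<..<b} \<Longrightarrow> \<bar>g p\<bar> \<le> M) \<Longrightarrow> bdd g"
  unfolding bdd_def by blast

lemma bdd_const: "bdd (\<lambda>p. M)"
  by (auto simp: bdd_def)

lemma bdd_add: "bdd g1 \<Longrightarrow> bdd g2 \<Longrightarrow> bdd (\<lambda>p. g1 p + g2 p)"
  unfolding bdd_def by (meson abs_triangle_ineq add_mono order_trans)

lemma bdd_uminus: "bdd g \<Longrightarrow> bdd (\<lambda>p. - g p)"
  by (simp add: bdd_def)

lemma bdd_diff: "bdd g1 \<Longrightarrow> bdd g2 \<Longrightarrow> bdd (\<lambda>p. g1 p - g2 p)"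
  using bdd_add[OF _ bdd_uminus] by auto

lemma bdd_mult:
  assumes "bdd g1" "bdd g2"
  shows "bdd (\<lambda>p. g1 p * g2 p)"
proof -
  obtain M1 M2 where M: "\<And>p. p \<in> {r<..<b} \<Longrightarrow> \<bar>g1 p\<bar> \<le> M1" "\<And>p. p \<in> {r<..<b} \<Longrightarrow> \<bar>g2 p\<bar> \<le> M2"
    using assms unfolding bdd_def by blast
  have "\<bar>g1 p * g2 p\<bar> \<le> M1 * M2" if "p \<in> {r<..<b}" for p
    unfolding abs_mult using M[OF that] by (intro mult_mono) auto
  then show ?thesis by (rule bddI)
qed

lemma bdd_power: "bdd g \<Longrightarrow> bdd (\<lambda>p. g p ^ n)"
  by (induction n) (auto intro: bdd_const bdd_mult)

lemmas bdd_intros = bdd_const bdd_add bdd_diff bdd_mult bdd_power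

text \<open>A function of \<open>p\<close> that is a continuous function of the scaled variables
  along the extremal inherits the bound on the compact box.\<close>

lemma bdd_scaled:
  assumes "continuous_on (dom_s b) F"
    and "\<And>p z o'. p \<in> {r<..<b} \<Longrightarrow> (p, z, o') \<in> scaled_box b z0 z1 w0 \<Longrightarrow>
      0 \<le> p \<Longrightarrow> p < b \<Longrightarrow> 0 < z \<Longrightarrow> vs b p z = v p \<Longrightarrow> 1 + (b - p) * o' = D1 b v p \<Longrightarrow> g p = F (p, z, o')"
  shows "bdd g"
proof -
  obtain M where M: "\<And>x. x \<in> scaled_box b z0 z1 w0 \<Longrightarrow> \<bar>F x\<bar> \<le> M"
    using bounded_on_box[OF z0 assms(1)] by metis
  have "\<bar>g p\<bar> \<le> M" if p: "p \<in> {r<..<b}" for p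
  proof -
    have p': "p \<in> {0..<b}" using p r by auto
    have "g p = F (p, (v p - p) / (b - p)\<^sup>2, (D1 b v p - 1) / (b - p))"
      by (rule assms(2)[OF p mem[OF p']])
        (use p' gt(1)[OF p'] in \<open>auto simp: vs_def\<close>)
    then show ?thesis using M[OF mem[OF p']] by simp
  qed
  then show ?thesis by (rule bddI)
qed

text \<open>Each part of \<open>T\<close> is at most of order \<open>s\<close> by itself:
  \<open>\<phi> * h\<close> as \<open>s^-1 * s^2\<close>, \<open>X * h^2 / \<xi>\<close> as
  \<open>s^-2 * s^4 * s^-1\<close>, every summand of \<open>R\<close> as \<open>s\<close>, and
  \<open>H\<close> even as \<open>s^4\<close>. The functions \<open>\<eta>\<close>,
  \<open>\<zeta>\<close> are \<open>h\<close> and \<open>\<xi>\<close> in their own scale.\<close>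

lemma T_bound: "\<exists>M. \<forall>p\<in>{r<..<b}. \<bar>T p\<bar> \<le> M * (b - p)"
proof -
  let ?s = "\<lambda>p. b - p" and ?w = "D1 b v"
  define \<eta> where "\<eta> p = h p / (b - p)\<^sup>2" for p
  define \<zeta> where "\<zeta> p = \<xi> p / (b - p)" for p
  have in0: "p \<in> {0..<b}" if "p \<in> {r<..<b}" for p using that r by auto
  have s: "bdd ?s" by (rule bddI[of _ b]) (use r in auto)
  have \<eta>: "bdd \<eta>"
    by (rule bddI[of _ \<epsilon>]) (use h_le[OF in0] in \<open>auto simp: \<eta>_def abs_divide divide_le_eq\<close>)
  have \<zeta>: "bdd \<zeta>"
    by (rule bddI[of _ C]) (use C(2)[OF in0] in \<open>auto simp: \<zeta>_def abs_divide divide_le_eq\<close>)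
  have \<zeta>i: "bdd (\<lambda>p. inverse (\<zeta> p))"
  proof (rule bddI[of _ "inverse c"])
    fix p assume p: "p \<in> {r<..<b}"
    then have "c \<le> \<bar>\<zeta> p\<bar>" using c(2)[OF in0[OF p]] by (simp add: \<zeta>_def abs_divide le_divide_eq)
    then show "\<bar>inverse (\<zeta> p)\<bar> \<le> inverse c" using c(1) by (simp add: abs_inverse le_imp_inverse_le)
  qed
  have \<xi>': "bdd (D1 b \<xi>)" by (rule bddI) (use C(3)[OF in0] in auto)
  have B0: "bdd (\<lambda>p. NN k p (v p) / ?s p)"
  proof (rule bdd_scaled[OF continuous_on_NNS[OF b]], goal_cases)
    case (1 p z o')
    then show ?case using scaled_eqs(1)[OF b, of p z o'] by (simp add: k_def)
  qed
  have B1: "bdd (\<lambda>p. ?s p * NNv k p (v p))"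
  proof (rule bdd_scaled[OF continuous_on_NNvS[OF b]], goal_cases)
    case (1 p z o')
    then show ?case using scaled_eqs(2)[OF b, of p z o'] by (simp add: k_def)
  qed
  have B2: "bdd (\<lambda>p. ?s p ^ 3 * NNvv k p (v p))"
  proof (rule bdd_scaled[OF continuous_on_NNvvS[OF b]], goal_cases)
    case (1 p z o')
    then show ?case using scaled_eqs(3)[OF b, of p z o'] by (simp add: k_def)
  qed
  have B3: "bdd (\<lambda>p. LLw k p (v p) (?w p))"
  proof (rule bdd_scaled[OF continuous_on_LLwS[OF b]], goal_cases)
    case (1 p z o')
    then show ?case using scaled_eqs(4)[OF b, of p z o'] by (simp add: k_def)
  qed
  have B4: "bdd (\<lambda>p. LLvw k p (v p) (?w p))"
  proof (rule bdd_scaled[OF continuous_on_LvwS[OF b]], goal_cases)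
    case (1 p z o')
    then show ?case using LL_scaled(2)[OF b, of p z o'] by (simp add: k_def)
  qed
  have B5: "bdd (\<lambda>p. LLww p (v p) / ?s p)"
  proof (rule bdd_scaled[OF continuous_on_LwwS[OF b]], goal_cases)
    case (1 p z o')
    then show ?case using LL_scaled(3)[OF b, of p z o'] by (simp add: k_def)
  qed
  \<comment> \<open>Here \<open>NN\<close> is evaluated on \<open>v + h\<close>, hence the scaled
    point of \<open>mem_h\<close> replaces that of \<open>mem\<close>.\<close>
  have B6: "bdd (\<lambda>p. NN k p (v p + h p) / ?s p)"
  proof -
    obtain M where M: "\<And>x. x \<in> scaled_box b z0 z1 w0 \<Longrightarrow> \<bar>NNS b x\<bar> \<le> M"
      using bounded_on_box[OF z0 continuous_on_NNS[OF b]] by metis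
    have "\<bar>NN k p (v p + h p) / ?s p\<bar> \<le> M" if p: "p \<in> {r<..<b}" for p
    proof -
      have p': "p \<in> {0..<b}" by (rule in0[OF p])
      define z where "z = (v p - p) / (b - p)\<^sup>2 + h p / (b - p)\<^sup>2"
      define o' where "o' = (D1 b v p - 1) / (b - p) + D1 b h p / (b - p)"
      have "(p, z, o') \<in> scaled_box b z0 z1 w0" using mem_h[OF p'] by (simp add: z_def o'_def)
      moreover from this have "0 < z" using z0 by (simp add: scaled_box_def)
      moreover have "vs b p z = v p + h p" using p by (simp add: vs_def z_def distrib_left)
      ultimately show ?thesis
        using scaled_eqs(1)[OF b, of p z o'] M[of "(p, z, o')"] p' by (simp add: k_def)
    qed
    then show ?thesis by (rule bddI)
  qed
  define G where "G p = (?s p * LLw k p (v p) (?w p) + ?s p * NNv k p (v p)) * \<eta> p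
    + (?s p ^ 3 * (LLww p (v p) / ?s p) * D1 b \<xi> p + ?s p ^ 3 * LLvw k p (v p) (?w p) * \<zeta> p
        + ?s p ^ 3 * NNvv k p (v p) * \<zeta> p) * (\<eta> p)\<^sup>2 * inverse (\<zeta> p) * (1 / 2)
    + (NN k p (v p + h p) / ?s p - NN k p (v p) / ?s p - ?s p * NNv k p (v p) * \<eta> p
        - ?s p ^ 3 * NNvv k p (v p) * (\<eta> p)\<^sup>2 * (1 / 2))
    + a * c\<^sup>2 / 4 * ?s p ^ 3 * (\<eta> p)\<^sup>2 * (inverse (\<zeta> p))\<^sup>2" for p
  have "bdd G"
    unfolding G_def[abs_def]
    by (intro bdd_intros s \<eta> \<zeta> \<zeta>i \<xi>' B0 B1 B2 B3 B4 B5 B6)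
  moreover have "T p = G p * ?s p" if p: "p \<in> {r<..<b}" for p
  proof -
    note p' = in0[OF p]
    have sp: "?s p \<noteq> 0" using p by simp
    have h: "h p = (?s p)\<^sup>2 * \<eta> p" and \<xi>: "\<xi> p = ?s p * \<zeta> p" using sp by (simp_all add: \<eta>_def \<zeta>_def)
    have nz: "\<zeta> p \<noteq> 0" using \<xi>_nz[OF p'] \<xi> by auto
    have \<psi>p: "\<psi> p = 0" using p \<psi>_r by auto
    \<comment> \<open>On \<open>{r<..<b}\<close> the multiplier \<open>\<psi>\<close> vanishes
      identically, so \<open>\<psi>' = 0\<close> and \<open>\<phi> = f_w\<close>.\<close>
    have \<phi>p: "\<phi> p = LLw k p (v p) (?w p) + NNv k p (v p)"
    proof -
      have "at p within {0..<b} = at p"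
        using p r by (intro at_within_open_subset[of p "{r<..<b}"]) auto
      then have "(\<psi> has_real_derivative (f_w p (v p) (?w p) - \<phi> p)) (at p)"
        using \<psi>[OF p'] by simp
      moreover have "(\<psi> has_real_derivative 0) (at p)"
        by (rule has_field_derivative_transform_within_open[OF DERIV_const[of 0], of "{r<..<b}"])
          (use p \<psi>_r in auto)
      ultimately have "f_w p (v p) (?w p) - \<phi> p = 0" by (rule DERIV_unique)
      then show ?thesis using f_w_eq[of p "v p" "?w p" k] gt(1)[OF p'] p' by simp
    qed
    have X: "X p = LLww p (v p) * D1 b \<xi> p + (LLvw k p (v p) (?w p) + NNvv k p (v p)) * \<xi> p"
      unfolding X_def using f_ww_eq[of p "v p" "?w p"] f_vw_eq[of p "v p" "?w p" k] gt(1)[OF p'] p' by simp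
    have 1: "\<phi> p * h p = (?s p * LLw k p (v p) (?w p) + ?s p * NNv k p (v p)) * \<eta> p * ?s p"
      unfolding \<phi>p h by algebra
    have 2: "X p * (h p)\<^sup>2 / (2 * \<xi> p) = (?s p ^ 3 * (LLww p (v p) / ?s p) * D1 b \<xi> p
        + ?s p ^ 3 * LLvw k p (v p) (?w p) * \<zeta> p
        + ?s p ^ 3 * NNvv k p (v p) * \<zeta> p) * (\<eta> p)\<^sup>2 * inverse (\<zeta> p) * (1 / 2) * ?s p"
      unfolding X h unfolding \<xi>
      using sp nz by (simp add: field_simps power2_eq_square power3_eq_cube)
    have 3: "R p = (NN k p (v p + h p) / ?s p - NN k p (v p) / ?s p - ?s p * NNv k p (v p) * \<eta> p
        - ?s p ^ 3 * NNvv k p (v p) * (\<eta> p)\<^sup>2 * (1 / 2)) * ?s p"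
    proof -
      have "N1 - N2 - Nv * (t\<^sup>2 * e) - Nvv * (t\<^sup>2 * e)\<^sup>2 / 2
        = (N1 / t - N2 / t - t * Nv * e - t ^ 3 * Nvv * e\<^sup>2 * (1 / 2)) * t" if "t \<noteq> 0"
        for N1 N2 Nv Nvv t e :: real
        using that by (simp add: field_simps power2_eq_square power3_eq_cube)
      from this[OF sp] show ?thesis
        unfolding R_def using h by metis
    qed
    have 4: "H p = a * c\<^sup>2 / 4 * ?s p ^ 3 * (\<eta> p)\<^sup>2 * (inverse (\<zeta> p))\<^sup>2 * ?s p"
    proof -
      have "h p / \<xi> p = ?s p * \<eta> p * inverse (\<zeta> p)"
        using sp nz unfolding h \<xi> by (simp add: field_simps power2_eq_square)
      then show ?thesis unfolding H_def by algebra
    qed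
    show ?thesis
      unfolding T_def T1_def 1 2 3 4 G_def \<psi>p by (simp only: distrib_right mult_zero_left add_0_right)
  qed
  ultimately obtain M where M: "\<And>p. p \<in> {r<..<b} \<Longrightarrow> \<bar>G p\<bar> \<le> M" "\<And>p. p \<in> {r<..<b} \<Longrightarrow> T p = G p * ?s p"
    unfolding bdd_def by blast
  have "\<bar>T p\<bar> \<le> M * ?s p" if "p \<in> {r<..<b}" for p
    using M(1)[OF that] that unfolding M(2)[OF that] abs_mult by (intro mult_mono) auto
  then show ?thesis by blast
qed

lemma T_continuous: "continuous_on {0..<b} T"
proof -
  have "continuous_on {0..<b} T1" "continuous_on {0..<b} \<psi>"
    using DERIV_continuous_on[OF T1_deriv] DERIV_continuous_on[OF \<psi>] by auto
  moreover have "continuous_on {0..<b} (D1 b h)"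
    using C1h by (auto simp: C1_on_def elim: continuous_on_subset)
  ultimately show ?thesis
    unfolding T_def[abs_def] by (intro continuous_intros)
qed

text \<open>Off the finite set \<open>S\<close> one has \<open>T' \<le> \<Delta>\<close>: the extra
  term \<open>\<psi> * h''\<close> is nonpositive on the affine arc, where
  \<open>\<psi> \<le> 0 \<le> h''\<close>, and zero on the singular arc. Integration starts from
  \<open>T 0 = 0\<close>, which follows from \<open>h 0 = 0\<close> and
  \<open>\<psi> 0 = 0\<close>.\<close>

lemma integral_nonneg_partial:
  assumes "\<Delta> integrable_on {0..b}" and q: "q \<in> {r<..<b}"
  shows "T q \<le> integral {0..q} \<Delta>"
proof -
  define T' where "T' p = T1' p + (f_w p (v p) (D1 b v p) - \<phi> p) * D1 b h p + \<psi> p * D2 b h p" for p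
  have DT: "(T has_real_derivative T' p) (at p)" if p: "p \<in> {0<..<q} - S" for p
  proof -
    have p': "p \<in> {0..<b}" and p'': "p \<in> {0<..<b} - S" using p q by auto
    have "at p within {0..<b} = at p"
      using p'' by (intro at_within_open_subset[of p "{0<..<b}"]) auto
    then have "(T1 has_real_derivative T1' p) (at p)"
      "(\<psi> has_real_derivative (f_w p (v p) (D1 b v p) - \<phi> p)) (at p)"
      using T1_deriv[OF p'] \<psi>[OF p'] by simp_all
    then show ?thesis
      unfolding T_def[abs_def] T'_def
      by (auto intro!: derivative_eq_intros h''[OF p''])
  qed
  have le: "T' p \<le> \<Delta> p" if p: "p \<in> {0<..<q} - S" for p
  proof -
    have p': "p \<in> {0..<b}" using p q by auto
    have "\<psi> p * D2 b h p \<le> 0"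
    proof (cases "p < r")
      case True
      then show ?thesis
        using p p' h''_nonneg[of p] \<psi>_le[of p] by (auto intro: mult_nonpos_nonneg)
    next
      case False
      then show ?thesis using \<psi>_r[of p] p' by simp
    qed
    then show ?thesis using T_deriv_le[OF p'] by (simp add: T'_def)
  qed
  have "(T' has_integral (T q - T 0)) {0..q}"
    using q r S(1) DT
    by (intro fundamental_theorem_of_calculus_interior_strong[of S])
      (auto simp: has_real_derivative_iff_has_vector_derivative intro: continuous_on_subset[OF T_continuous])
  \<comment> \<open>\<open>T'\<close> is replaced by \<open>\<Delta>\<close> at the exceptional
    points, so that the comparison of integrands holds everywhere.\<close>
  then have "((\<lambda>p. if p \<in> S \<union> {0, q} then \<Delta> p else T' p) has_integral (T q - T 0)) {0..q}"
    by (rule has_integral_spike_finite[of "S \<union> {0, q}", rotated 2]) (use S in auto)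
  moreover have "(\<Delta> has_integral integral {0..q} \<Delta>) {0..q}"
    using assms by (intro integrable_integral integrable_on_subinterval[OF assms(1)]) auto
  ultimately have "T q - T 0 \<le> integral {0..q} \<Delta>"
    by (rule has_integral_le) (use le in auto)
  moreover have "T 0 = 0"
    by (simp add: T_def T1_def R_def H_def h_0 \<psi>_0)
  ultimately show ?thesis by simp
qed

text \<open>The limit \<open>q \<rightarrow> b\<close> of the previous estimate: the integral is
  continuous in its upper limit, and \<open>T q \<rightarrow> 0\<close> by
  \<open>T_bound\<close>.\<close>

lemma integral_\<Delta>_nonneg:
  assumes "\<Delta> integrable_on {0..b}"
  shows "0 \<le> integral {0..b} \<Delta>"
proof -
  obtain M where M: "\<And>p. p \<in> {r<..<b} \<Longrightarrow> \<bar>T p\<bar> \<le> M * (b - p)" using T_bound by blast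
  have "((\<lambda>q. integral {0..q} \<Delta>) \<longlongrightarrow> integral {0..b} \<Delta>) (at b within {0..b})"
    using indefinite_integral_continuous_1[OF assms] b by (auto simp: continuous_on_def)
  then have lim: "((\<lambda>q. integral {0..q} \<Delta>) \<longlongrightarrow> integral {0..b} \<Delta>) (at_left b)"
    using at_within_Icc_at_left[OF b] by simp
  have "((\<lambda>q. - M * (b - q)) \<longlongrightarrow> - M * (b - b)) (at_left b)"
    by (intro tendsto_intros)
  moreover have "\<forall>\<^sub>F q in at_left b. - M * (b - q) \<le> integral {0..q} \<Delta>"
    using eventually_at_left_real[OF r(2)]
  proof (rule eventually_mono)
    fix q assume q: "q \<in> {r<..<b}"
    show "- M * (b - q) \<le> integral {0..q} \<Delta>"
      using M[OF q] integral_nonneg_partial[OF assms q] by (auto simp: abs_le_iff)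
  qed
  ultimately have "- M * (b - b) \<le> integral {0..b} \<Delta>"
    by (intro tendsto_le[OF _ lim]) auto
  then show ?thesis by simp
qed

end

section \<open>Choice of the constants and local minimality\<close>

lemma LwwS_lower_bound:
  assumes b: "0 < b" and z0: "0 < z0"
  obtains a where "0 < a" "\<And>x. x \<in> scaled_box b z0 z1 w \<Longrightarrow> a \<le> LwwS b x"
proof -
  have pos: "0 < LwwS b x" if "x \<in> dom_s b" for x
    using that us_pos[OF b]
    by (auto simp: dom_s_def LwwS_def gg_def intro!: divide_pos_pos zero_less_power one_sq_pos)
  have "continuous_on (dom_s b) (\<lambda>x. inverse (LwwS b x))"
    using pos by (intro continuous_intros continuous_on_LwwS[OF b]) force
  then obtain M where M: "0 < M" "\<And>x. x \<in> scaled_box b z0 z1 w \<Longrightarrow> \<bar>inverse (LwwS b x)\<bar> \<le> M"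
    using bounded_on_box[OF z0] by metis
  show ?thesis
  proof (rule that[of "inverse M"])
    fix x assume x: "x \<in> scaled_box b z0 z1 w"
    then have "0 < LwwS b x" using pos scaled_box_subset[OF z0] by blast
    then show "inverse M \<le> LwwS b x"
      using M(2)[OF x] le_imp_inverse_le[of "inverse (LwwS b x)" M] by simp
  qed (use M in simp)
qed

text \<open>The constants are fixed in the order box, \<open>a\<close>, \<open>d\<close>,
  \<open>e\<close>, \<open>\<epsilon>\<close>, all depending on the extremal alone; only then is
  \<open>h\<close> introduced.\<close>

lemma field_extremal_local_min:
  assumes ext: "field_extremal b r v"
  shows "\<exists>\<epsilon>>0. \<forall>h. PC2 b h \<and> h 0 = 0 \<and> h b = 0 \<and> D1 b h b = 0 \<and>
           sup_norm (dom2 b h) (D2 b h) \<le> ereal \<epsilon> \<and> convex_on {0..b} (\<lambda>p. v p + h p)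
         \<longrightarrow> J b (\<lambda>p. v p + h p) \<ge> J b v"
proof -
  have r: "0 < r" "r < b" and C1v: "C1_on b v"
    and vb: "v b = b" "D1 b v b = 1" and gt: "\<And>p. p \<in> {0..<b} \<Longrightarrow> p < v p"
    and sing: "singular_arc b r v"
    using ext unfolding field_extremal_def PC2_def by blast+
  have b: "0 < b" using r by simp
  obtain cc dd where aff: "\<And>p. p \<in> {0..r} \<Longrightarrow> v p = cc + dd * p"
    using ext unfolding field_extremal_def by blast
  obtain \<phi> \<psi> where pont: "pontryagin b v \<phi> \<psi>" and \<psi>_r: "\<And>p. p \<in> {r..b} \<Longrightarrow> \<psi> p = 0"
    using ext unfolding field_extremal_def by blast
  obtain \<xi> where jac: "jacobi_solution b v \<xi>" and \<xi>_nz: "\<And>p. p \<in> {0..<b} \<Longrightarrow> \<xi> p \<noteq> 0"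
    using ext unfolding field_extremal_def by blast
  have C1\<xi>: "C1_on b \<xi>" and \<xi>b: "\<xi> b = 0" "D1 b \<xi> b = 1"
    using jac unfolding jacobi_solution_def by blast+
  obtain z0 z1 w where zw: "0 < z0" "0 < z1" "0 < w"
    and z_ge: "\<And>p. p \<in> {0..<b} \<Longrightarrow> z0 * (b - p)\<^sup>2 \<le> v p - p"
    and z_le: "\<And>p. p \<in> {0..<b} \<Longrightarrow> v p - p \<le> z1 * (b - p)\<^sup>2"
    and w_le: "\<And>p. p \<in> {0..<b} \<Longrightarrow> \<bar>D1 b v p - 1\<bar> \<le> w * (b - p)"
    by (rule singular_arc_bounds[OF r C1v gt vb sing]) (assumption, rule that)
  obtain c C where cC: "0 < c" "0 < C"
    and \<xi>_bounds: "\<And>p. p \<in> {0..<b} \<Longrightarrow> c * (b - p) \<le> \<bar>\<xi> p\<bar>"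
      "\<And>p. p \<in> {0..<b} \<Longrightarrow> \<bar>\<xi> p\<bar> \<le> C * (b - p)"
      "\<And>p. p \<in> {0..<b} \<Longrightarrow> \<bar>D1 b \<xi> p\<bar> \<le> C"
    by (rule jacobi_bounds[OF b C1\<xi> \<xi>b \<xi>_nz]) (assumption, rule that)
  \<comment> \<open>The bounds of the extremal are relaxed so that the box also holds the perturbed
    curve.\<close>
  define Z0 Z1 W where "Z0 = z0 / 2" and "Z1 = z1 + 1" and "W = w + 1"
  have Z0: "0 < Z0" using zw by (simp add: Z0_def)
  obtain a where a: "0 < a" "\<And>x. x \<in> scaled_box b Z0 Z1 W \<Longrightarrow> a \<le> LwwS b x"
    by (rule LwwS_lower_bound[OF b Z0]) (rule that)
  define d where "d = a * c\<^sup>2 / (12 * C\<^sup>2)"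
  have d: "0 < d" using a cC by (simp add: d_def)
  obtain e where e: "0 < e" and remainder: "\<And>p z o' x y. \<lbrakk>0 \<le> p; p < b; (p, z, o') \<in> scaled_box b Z0 Z1 W;
      (p, z + x, o' + y) \<in> scaled_box b Z0 Z1 W; \<bar>x\<bar> \<le> e; \<bar>y\<bar> \<le> e\<rbrakk> \<Longrightarrow>
      let v = vs b p z; w = 1 + (b - p) * o'; h = (b - p)\<^sup>2 * x; h' = (b - p) * y; k = ee b in
      LL k p (v + h) (w + h') - LL k p v w - (LLv k p v w * h + LLw k p v w * h')
       - (LLvv k p v w * h\<^sup>2 + 2 * LLvw k p v w * h * h' + LLww p v * h'\<^sup>2) / 2
      \<ge> - d * (b - p) ^ 3 * (x\<^sup>2 + y\<^sup>2)"
    by (rule LL_remainder[OF b Z0 d]) (rule that)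
  \<comment> \<open>\<open>\<epsilon> \<le> Z0 = z0 / 2\<close> and
    \<open>\<epsilon> \<le> 1\<close> keep \<open>v + h\<close> in the relaxed box, and
    \<open>\<epsilon> \<le> e\<close> makes the remainder estimate applicable.\<close>
  define \<epsilon> where "\<epsilon> = min e (min Z0 1)"
  have \<epsilon>: "0 < \<epsilon>" "\<epsilon> \<le> e" "\<epsilon> \<le> Z0" "\<epsilon> \<le> 1" using e Z0 by (auto simp: \<epsilon>_def)
  have "J b (\<lambda>p. v p + h p) \<ge> J b v"
    if h: "PC2 b h" "h 0 = 0" "h b = 0" "D1 b h b = 0"
      and small: "sup_norm (dom2 b h) (D2 b h) \<le> ereal \<epsilon>"
      and conv: "convex_on {0..b} (\<lambda>p. v p + h p)" for h
  proof -
    have C1h: "C1_on b h" using h by (simp add: PC2_def)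
    have D2h: "\<bar>D2 b h p\<bar> \<le> \<epsilon>" if "p \<in> dom2 b h" for p
      using small that by (auto simp: sup_norm_def SUP_le_iff)
    have h_le: "\<bar>h p\<bar> \<le> \<epsilon> * (b - p)\<^sup>2" "\<bar>D1 b h p\<bar> \<le> \<epsilon> * (b - p)" if "p \<in> {0..<b}" for p
      using PC2_small[OF h(1,3,4) _ D2h, of p] \<epsilon>(1) that by auto
    obtain S0 where S0: "finite S0" "{0..b} - S0 \<subseteq> dom2 b h" using h(1) by (auto simp: PC2_def)
    have mem: "(p, (v p - p) / (b - p)\<^sup>2, (D1 b v p - 1) / (b - p)) \<in> scaled_box b Z0 Z1 W"
      and mem_h: "(p, (v p - p) / (b - p)\<^sup>2 + h p / (b - p)\<^sup>2,
        (D1 b v p - 1) / (b - p) + D1 b h p / (b - p)) \<in> scaled_box b Z0 Z1 W"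
      if p: "p \<in> {0..<b}" for p
    proof -
      have s: "0 < b - p" "0 < (b - p)\<^sup>2" using p by auto
      have z: "z0 \<le> (v p - p) / (b - p)\<^sup>2" "(v p - p) / (b - p)\<^sup>2 \<le> z1"
        using z_ge[OF p] z_le[OF p] s by (simp_all add: le_divide_eq divide_le_eq)
      have o: "\<bar>(D1 b v p - 1) / (b - p)\<bar> \<le> w"
        using w_le[OF p] s by (simp add: abs_divide divide_le_eq)
      have x: "\<bar>h p / (b - p)\<^sup>2\<bar> \<le> \<epsilon>" "\<bar>D1 b h p / (b - p)\<bar> \<le> \<epsilon>"
        using h_le[OF p] s by (simp_all add: abs_divide divide_le_eq)
      show "(p, (v p - p) / (b - p)\<^sup>2, (D1 b v p - 1) / (b - p)) \<in> scaled_box b Z0 Z1 W"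
        using z o zw p unfolding scaled_box_def Z0_def Z1_def W_def
        unfolding abs_le_iff mem_Times_iff fst_conv snd_conv atLeastAtMost_iff atLeastLessThan_iff
        by (intro conjI; linarith)
      show "(p, (v p - p) / (b - p)\<^sup>2 + h p / (b - p)\<^sup>2,
          (D1 b v p - 1) / (b - p) + D1 b h p / (b - p)) \<in> scaled_box b Z0 Z1 W"
        using z o x \<epsilon> zw p unfolding scaled_box_def Z0_def Z1_def W_def
        unfolding abs_le_iff mem_Times_iff fst_conv snd_conv atLeastAtMost_iff atLeastLessThan_iff
        by (intro conjI; linarith)
    qed
    have D1h: "(D1 b h has_real_derivative D2 b h p) (at p)" if "p \<in> {0<..<b} - insert r S0" for p
    proof -
      have "p \<in> dom2 b h" "p \<in> {0<..<b}" using that S0(2) by auto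
      then show ?thesis using dom2_DERIV[of p b h] at_within_Icc_interior[of p b] by simp
    qed
    have D2h_nonneg: "0 \<le> D2 b h p" if "p \<in> {0<..<r} - insert r S0" for p
      using that S0(2) r by (intro affine_convex_D2_nonneg[OF r C1h conv aff]) auto
    have rem: "let v = vs b p z; w = 1 + (b - p) * o'; h = (b - p)\<^sup>2 * x; h' = (b - p) * y; k = ee b in
      LL k p (v + h) (w + h') - LL k p v w - (LLv k p v w * h + LLw k p v w * h')
       - (LLvv k p v w * h\<^sup>2 + 2 * LLvw k p v w * h * h' + LLww p v * h'\<^sup>2) / 2
      \<ge> - d * (b - p) ^ 3 * (x\<^sup>2 + y\<^sup>2)"
      if "0 \<le> p" "p < b" "(p, z, o') \<in> scaled_box b Z0 Z1 W" "(p, z + x, o' + y) \<in> scaled_box b Z0 Z1 W"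
        "\<bar>x\<bar> \<le> \<epsilon>" "\<bar>y\<bar> \<le> \<epsilon>" for p z o' x y
      by (rule remainder[OF that(1-4)]) (use that(5,6) \<epsilon>(2) in linarith)+
    have fin: "finite (insert r S0)" using S0 by simp
    have jacobi: "((\<lambda>q. f_ww q (v q) (D1 b v q) * D1 b \<xi> q + f_vw q (v q) (D1 b v q) * \<xi> q)
           has_real_derivative
           (f_vw p (v p) (D1 b v p) * D1 b \<xi> p + f_vv p (v p) (D1 b v p) * \<xi> p))
        (at p within {0..<b})" if "p \<in> {0..<b}" for p
      using jac that unfolding jacobi_solution_def by blast
    have \<phi>: "(\<phi> has_real_derivative f_v p (v p) (D1 b v p)) (at p within {0..<b})"
      and \<psi>: "(\<psi> has_real_derivative (f_w p (v p) (D1 b v p) - \<phi> p)) (at p within {0..<b})"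
      if "p \<in> {0..<b}" for p
      using pont that unfolding pontryagin_def by blast+
    have \<psi>_le: "\<psi> p \<le> 0" if "p \<in> {0..b}" for p
      using pont that unfolding pontryagin_def by blast
    have \<psi>_0: "\<psi> 0 = 0" using pont unfolding pontryagin_def by blast
    interpret variation b r Z0 Z1 W \<epsilon> a c C d v h \<phi> \<psi> \<xi> "insert r S0"
      by (rule variation.intro[OF r Z0 \<epsilon>(1) C1v C1h mem mem_h h_le rem a d_def cC(1) \<xi>_bounds(1)
            cC(2) \<xi>_bounds(2,3) C1\<xi> jacobi \<phi> \<psi> \<psi>_0 \<psi>_r \<psi>_le h(2) fin insertI1 D1h D2h_nonneg])
    have cont: "continuous_on {0..b} v" "continuous_on {0..b} (D1 b v)"
      "continuous_on {0..b} h" "continuous_on {0..b} (D1 b h)"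
      using C1v C1h C1_on_continuous by (auto simp: C1_on_def)
    have int_v: "(\<lambda>p. f p (v p) (D1 b v p)) integrable_on {0..b}"
      by (rule f_integrable[OF b Z0 cont(1,2) mem])
    have int_h: "(\<lambda>p. f p (v p + h p) (D1 b v p + D1 b h p)) integrable_on {0..b}"
    proof (rule f_integrable[OF b Z0])
      show "(p, (v p + h p - p) / (b - p)\<^sup>2, (D1 b v p + D1 b h p - 1) / (b - p)) \<in> scaled_box b Z0 Z1 W"
        if "p \<in> {0..<b}" for p
        using mem_h[OF that] by (simp add: add_divide_distrib[symmetric] algebra_simps)
    qed (intro continuous_intros cont)+
    have "J b (\<lambda>p. v p + h p) = integral {0..b} (\<lambda>p. f p (v p + h p) (D1 b v p + D1 b h p))"
      unfolding J_def by (rule integral_cong) (simp add: D1_add[OF b C1v C1h])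
    then have "J b (\<lambda>p. v p + h p) - J b v = integral {0..b} \<Delta>"
      unfolding J_def \<Delta>_def using integral_diff[OF int_h int_v] by simp
    moreover have "\<Delta> integrable_on {0..b}"
      unfolding \<Delta>_def by (rule integrable_diff[OF int_h int_v])
    ultimately show ?thesis using integral_\<Delta>_nonneg by simp
  qed
  then show ?thesis using \<epsilon>(1) by blast
qed

theorem theorem6:
  fixes P\<^sub>0 p\<^sub>0 :: real and r :: "real \<Rightarrow> real"
    and V :: "real \<Rightarrow> real \<Rightarrow> real" and vhat :: "real \<Rightarrow> real"
  assumes "field_of_extremals P\<^sub>0 r V"
    and "P\<^sub>0 \<le> p\<^sub>0"
    and "vhat = V p\<^sub>0"
  shows "\<exists>\<epsilon>>0. \<forall>h. PC2 p\<^sub>0 h \<and> h 0 = 0 \<and> h p\<^sub>0 = 0 \<and> D1 p\<^sub>0 h p\<^sub>0 = 0 \<and>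
           sup_norm (dom2 p\<^sub>0 h) (D2 p\<^sub>0 h) \<le> ereal \<epsilon> \<and>
           convex_on {0..p\<^sub>0} (\<lambda>p. vhat p + h p)
         \<longrightarrow> J p\<^sub>0 (\<lambda>p. vhat p + h p) \<ge> J p\<^sub>0 vhat"
proof -
  have "field_extremal p\<^sub>0 (r p\<^sub>0) vhat"
    using assms by (simp add: field_of_extremals_def)
  then show ?thesis by (rule field_extremal_local_min)
qed

end
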